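(* Let $k$ be a field, $R=k[x,y]$, and let $I\subset R$ be an $(x,y)$-primary ideal minimally generated by three forms of degree $n$, with minimal free resolution $0\to R^2\xrightarrow{\varphi}R^3\to I\to 0$, where the entries of the first column of $\varphi$ have degree $r$ and those of the second column have degree $s\ge r$ (so $n=r+s$). Let $\mathbf{B}$ be the $s\times s$ matrix with entries in $k[T_1,T_2,T_3]$ defined in the context. Then, both when $s=r$ and when $s>r$, $\det\mathbf{B}$ is a nonzero polynomial of degree $n$.
   Context: Let $S=R[T_1,T_2,T_3]$, bigraded so that $x,y$ have bidegree $(1,0)$ and the $T_i$ have bidegree $(0,1)$. Define $f,g\in S$ by $[f,g]=[T_1,T_2,T_3]\cdot\varphi$; thus $f$ has bidegree $(r,1)$ and $g$ has bidegree $(s,1)$. Let $N=(f,g):_S(x,y)^r$. By linkage $N$ is a perfect ideal of codimension two, minimally generated by $r+2$ elements, namely by $f$, $g$ and $r$ further forms $\mathbf{h}_1,\ldots,\mathbf{h}_r$ of bidegree $(s-1,2)$; fix such $\mathbf{h}_1,\dots,\mathbf{h}_r$. If $s=r$, the matrix $\mathbf{B}$ is defined by $$[\mathbf{h}_1\ \cdots\ \mathbf{h}_r]=[x^{r-1}\ \ x^{r-2}y\ \cdots\ xy^{r-2}\ \ y^{r-1}]\cdot\mathbf{B}.$$ If $s>r$, the matrix $\mathbf{B}$ is defined by $$[x^{s-r-1}f\ \ x^{s-r-2}yf\ \cdots\ y^{s-r-1}f\ \ \mathbf{h}_1\ \cdots\ \mathbf{h}_r]=[x^{s-1}\ \ x^{s-2}y\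 \cdots\ xy^{s-2}\ \ y^{s-1}]\cdot\mathbf{B}.$$ *)

theory Defs
  imports "HOL-Library.Poly_Mapping" "Jordan_Normal_Form.Determinant"
begin

text \<open>Polynomials over 'a in the variables 'v: finitely supported coefficient functions on the
  exponent vectors.\<close>

type_synonym ('v, 'a) mpoly = "('v \<Rightarrow>\<^sub>0 nat) \<Rightarrow>\<^sub>0 'a"

definition Const :: "'a::comm_ring_1 \<Rightarrow> ('v, 'a) mpoly" where
  "Const c = Poly_Mapping.single 0 c"

definition Var :: "'v \<Rightarrow> ('v, 'a::comm_ring_1) mpoly" where
  "Var v = Poly_Mapping.single (Poly_Mapping.single v 1) 1"

definition exp_degree :: "('v \<Rightarrow>\<^sub>0 nat) \<Rightarrow> nat" where
  "exp_degree m = (\<Sum>v\<in>Poly_Mapping.keys m. Poly_Mapping.lookup m v)"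

definition homogeneous :: "nat \<Rightarrow> ('v, 'a::comm_ring_1) mpoly \<Rightarrow> bool" where
  "homogeneous d p \<longleftrightarrow> (\<forall>m\<in>Poly_Mapping.keys p. exp_degree m = d)"

text \<open>The zero polynomial gets total degree 0.\<close>

definition total_degree :: "('v, 'a::comm_ring_1) mpoly \<Rightarrow> nat" where
  "total_degree p = Max (insert 0 (exp_degree ` Poly_Mapping.keys p))"

text \<open>R = k[x,y], k[T1,T2,T3], and S = R[T1,T2,T3].\<close>

datatype xyvar = X | Y
datatype tvar = T1 | T2 | T3

text \<open>The variables are ordered only because the library derives the integral domain instance of
  a polynomial ring from a linear order on the exponent vectors.\<close>

instantiation xyvar :: linorder
begin

definition less_eq_xyvar :: "xyvar \<Rightarrow> xyvar \<Rightarrow> bool" where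
  "a \<le> b \<longleftrightarrow> a = X \<or> b = Y"

definition less_xyvar :: "xyvar \<Rightarrow> xyvar \<Rightarrow> bool" where
  "a < b \<longleftrightarrow> a = X \<and> b = Y"

instance
proof
  fix a b c :: xyvar
  show "a < b \<longleftrightarrow> a \<le> b \<and> \<not> b \<le> a" "a \<le> a" "a \<le> b \<or> b \<le> a"
    by (cases a; cases b; simp add: less_eq_xyvar_def less_xyvar_def)+
  show "a \<le> b \<Longrightarrow> b \<le> c \<Longrightarrow> a \<le> c" "a \<le> b \<Longrightarrow> b \<le> a \<Longrightarrow> a = b"
    by (cases a; cases b; cases c; simp add: less_eq_xyvar_def)+
qed

end

instantiation tvar :: linorder
begin

definition less_eq_tvar :: "tvar \<Rightarrow> tvar \<Rightarrow> bool" where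
  "a \<le> b \<longleftrightarrow> a = T1 \<or> b = T3 \<or> a = b"

definition less_tvar :: "tvar \<Rightarrow> tvar \<Rightarrow> bool" where
  "a < b \<longleftrightarrow> (a = T1 \<or> b = T3) \<and> a \<noteq> b"

instance
proof
  fix a b c :: tvar
  show "a < b \<longleftrightarrow> a \<le> b \<and> \<not> b \<le> a" "a \<le> a" "a \<le> b \<or> b \<le> a"
    by (cases a; cases b; simp add: less_eq_tvar_def less_tvar_def)+
  show "a \<le> b \<Longrightarrow> b \<le> c \<Longrightarrow> a \<le> c" "a \<le> b \<Longrightarrow> b \<le> a \<Longrightarrow> a = b"
    by (cases a; cases b; cases c; simp add: less_eq_tvar_def)+
qed

end

type_synonym 'k R = "(xyvar, 'k) mpoly"
type_synonym 'k kT = "(tvar, 'k) mpoly"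
type_synonym 'k S = "(tvar, 'k R) mpoly"

definition xS :: "'k::field S" where "xS = Const (Var X)"
definition yS :: "'k::field S" where "yS = Const (Var Y)"

text \<open>The inclusion of k[T1,T2,T3] into S.\<close>

definition kT_to_S :: "'k::field kT \<Rightarrow> 'k S" where
  "kT_to_S p = Poly_Mapping.map Const p"

text \<open>The bigrading on S: x, y have bidegree (1,0) and the Ti have bidegree (0,1).\<close>

definition bihomogeneous :: "nat \<Rightarrow> nat \<Rightarrow> 'k::field S \<Rightarrow> bool" where
  "bihomogeneous i j p \<longleftrightarrow>
     (\<forall>t\<in>Poly_Mapping.keys p. exp_degree t = j \<and> homogeneous i (Poly_Mapping.lookup p t))"

text \<open>An ideal of a commutative ring is a submodule of the ring acting on itself by
  multiplication.\<close>

abbreviation is_ideal :: "'a::comm_ring_1 set \<Rightarrow> bool" where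
  "is_ideal \<equiv> Modules.module.subspace (*)"

abbreviation ideal_gen :: "'a::comm_ring_1 set \<Rightarrow> 'a set" where
  "ideal_gen \<equiv> Modules.module.span (*)"

lemma module_times: "Modules.module ((*) :: 'a::comm_ring_1 \<Rightarrow> 'a \<Rightarrow> 'a)"
  by unfold_locales (simp_all add: algebra_simps)

definition ideal_mult :: "'a::comm_ring_1 set \<Rightarrow> 'a set \<Rightarrow> 'a set" where
  "ideal_mult I J = ideal_gen {a * b | a b. a \<in> I \<and> b \<in> J}"

primrec ideal_power :: "'a::comm_ring_1 set \<Rightarrow> nat \<Rightarrow> 'a set" where
  "ideal_power I 0 = UNIV"
| "ideal_power I (Suc m) = ideal_mult I (ideal_power I m)"

definition colon :: "'a::comm_ring_1 set \<Rightarrow> 'a set \<Rightarrow> 'a set" where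
  "colon I J = {a. \<forall>b\<in>J. a * b \<in> I}"

definition radical :: "'a::comm_ring_1 set \<Rightarrow> 'a set" where
  "radical I = {a. \<exists>m. a ^ m \<in> I}"

definition primary_to :: "'a::comm_ring_1 set \<Rightarrow> 'a set \<Rightarrow> bool" where
  "primary_to P I \<longleftrightarrow> is_ideal I \<and> I \<noteq> UNIV \<and>
     (\<forall>a b. a * b \<in> I \<longrightarrow> a \<in> I \<or> b \<in> radical I) \<and> radical I = P"

text \<open>The list gs generates I and no entry can be omitted.\<close>

definition minimally_generated_by :: "'a::comm_ring_1 set \<Rightarrow> 'a list \<Rightarrow> bool" where
  "minimally_generated_by I gs \<longleftrightarrow> ideal_gen (set gs) = I \<and>
     (\<forall>i<length gs. ideal_gen {gs ! j | j. j < length gs \<and> j \<noteq> i} \<noteq> I)"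

definition max_ideal :: "'k::field R set" where
  "max_ideal = ideal_gen {Var X, Var Y}"

text \<open>phi presents a minimal free resolution of I, of the form 0 -> R^2 -> R^3 -> I -> 0, in which
  the basis of R^3 maps to ds: the augmentation is onto I, the complex is exact in the middle and
  on the left, and (minimality) the entries of phi lie in (x,y).\<close>

definition min_free_resolution :: "'k::field R set \<Rightarrow> 'k R list \<Rightarrow> 'k R mat \<Rightarrow> bool" where
  "min_free_resolution I ds phi \<longleftrightarrow>
     length ds = 3 \<and> phi \<in> carrier_mat 3 2 \<and>
     (\<lambda>w. vec_of_list ds \<bullet> w) ` carrier_vec 3 = I \<and>
     (\<lambda>v. phi *\<^sub>v v) ` carrier_vec 2 = {w \<in> carrier_vec 3. vec_of_list ds \<bullet> w = 0} \<and>
     inj_on (\<lambda>v. phi *\<^sub>v v) (carrier_vec 2) \<and>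
     (\<forall>i<3. \<forall>j<2. phi $$ (i, j) \<in> max_ideal)"

definition row_mat :: "'a list \<Rightarrow> 'a mat" where
  "row_mat xs = mat_of_rows_list (length xs) [xs]"

text \<open>The m monomials of degree m - 1 in x and y, in the order
  x^(m-1), x^(m-2) y, ..., y^(m-1).\<close>

definition xy_monomials :: "nat \<Rightarrow> 'k::field S list" where
  "xy_monomials m = map (\<lambda>i. xS ^ (m - 1 - i) * yS ^ i) [0..<m]"

definition is_B_matrix ::
  "nat \<Rightarrow> nat \<Rightarrow> 'k::field S \<Rightarrow> 'k S list \<Rightarrow> 'k kT mat \<Rightarrow> bool" where
  "is_B_matrix r s f hs B \<longleftrightarrow> B \<in> carrier_mat s s \<and>
     row_mat (if s = r then hs else map (\<lambda>m. m * f) (xy_monomials (s - r)) @ hs) =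
       row_mat (xy_monomials s) * map_mat kT_to_S B"

end

theory Submission
  imports Defs
begin

text \<open>Write \<open>T = (T1, T2, T3)\<close>, let \<open>d\<close> be the vector of the three generators of the ideal, and let
  \<open>a\<close>, \<open>b\<close> be the columns of \<open>phi\<close>, so that \<open>f = T \<bullet> a\<close> and \<open>g = T \<bullet> b\<close>. Call degree in \<open>x\<close> and \<open>y\<close> the
  xy-degree, and let \<open>N\<close> be the colon ideal.

  The columns of \<open>B\<close> are the coordinates over \<open>k[T]\<close>, in the monomials of xy-degree \<open>s - 1\<close>, of all products
  of xy-degree \<open>s - 1\<close> of a monomial in \<open>x\<close>, \<open>y\<close> with one of the generators \<open>f\<close>, \<open>g\<close>, \<open>hs\<close> of \<open>N\<close>; the form \<open>g\<close> has
  xy-degree \<open>s\<close> and contributes nothing. Suppose that some \<open>p \<noteq> 0\<close> in \<open>k[T]\<close> multiplies every monomial of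
  xy-degree \<open>s - 1\<close> into \<open>N\<close>. Comparing the parts of xy-degree \<open>s - 1\<close> in an expression of such a product by
  the generators (\<open>column_span\<close>) gives a matrix \<open>C\<close> with \<open>B * C = p \<cdot> 1\<close>, whence \<open>det B \<noteq> 0\<close>.
  Since \<open>N = (f, g) : (x, y)^r\<close>, it is enough that \<open>p\<close> multiplies all monomials of xy-degree \<open>r + s - 1\<close> into
  \<open>(f, g)\<close>. The resultant of \<open>f\<close> and \<open>g\<close>, the determinant of their Sylvester matrix, does this by the adjugate
  formula (\<open>resultant_in_ideal\<close>).

  The resultant is not zero. A vector in the kernel of the Sylvester matrix is a relation
  \<open>\<alpha> * f + \<beta> * g = 0\<close> with \<open>\<alpha>\<close>, \<open>\<beta>\<close> of xy-degree \<open>s - 1\<close>, \<open>r - 1\<close>. Then \<open>w = \<alpha> a + \<beta> b\<close> has xy-degree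
  \<open>r + s - 1\<close> and is orthogonal to \<open>T\<close> and to \<open>d\<close>. Every vector orthogonal to both is a multiple of the cross
  product \<open>T \<times> d\<close> (\<open>orthogonal_to_variables_and_constants\<close>), whose entries have xy-degree \<open>n = r + s\<close>;
  so \<open>w = 0\<close>, and \<open>\<alpha> = \<beta> = 0\<close> because \<open>phi\<close> is injective (\<open>forms_have_no_low_syzygy\<close>). That the
  generators have degree \<open>r + s\<close> is the degree part of the Hilbert-Burch theorem (\<open>degree_eq_sum\<close>). Both facts rest on
  depth two: the ideal contains powers of \<open>x\<close> and of \<open>y\<close>, and therefore a vector parallel to \<open>d\<close> is a
  multiple of \<open>d\<close> (\<open>parallel_is_multiple\<close>).

  Finally, a column of \<open>B\<close> that comes from \<open>f\<close> has degree 1 in \<open>T\<close>, and one that comes from \<open>hs\<close> has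
  degree 2, so \<open>det B\<close> is homogeneous of degree \<open>(s - r) + 2 r = n\<close>.\<close>

section \<open>Coefficients and degrees of polynomials\<close>

abbreviation coef :: "('m \<Rightarrow>\<^sub>0 'a::zero) \<Rightarrow> 'm \<Rightarrow> 'a" where
  "coef \<equiv> Poly_Mapping.lookup"

abbreviation mterm :: "'m \<Rightarrow> 'a::zero \<Rightarrow> 'm \<Rightarrow>\<^sub>0 'a" where
  "mterm \<equiv> Poly_Mapping.single"

lemma mpoly_as_sum:
  fixes p :: "'m \<Rightarrow>\<^sub>0 'a::comm_monoid_add"
  assumes "finite A" "Poly_Mapping.keys p \<subseteq> A"
  shows "p = (\<Sum>t\<in>A. mterm t (coef p t))"
proof (rule poly_mapping_eqI)
  fix t
  show "coef p t = coef (\<Sum>t\<in>A. mterm t (coef p t)) t"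
    using assms by (auto simp: lookup_sum lookup_single when_def in_keys_iff)
qed

lemma mpoly_induct [case_names zero add]:
  fixes P :: "('m \<Rightarrow>\<^sub>0 'a::comm_monoid_add) \<Rightarrow> bool"
  assumes "P 0" and "\<And>t c p. P p \<Longrightarrow> P (mterm t c + p)"
  shows "P p"
proof -
  have "P (\<Sum>t\<in>A. mterm t (coef p t))" if "finite A" for A
    using that by induction (auto intro: assms)
  from this[of "Poly_Mapping.keys p"] show ?thesis by (simp flip: mpoly_as_sum)
qed

lemma coef_mterm_times:
  fixes q :: "'m::cancel_comm_monoid_add \<Rightarrow>\<^sub>0 'a::comm_ring_1"
  shows "coef (mterm a c * q) (a + t) = c * coef q t"
  by (induction q rule: mpoly_induct)
    (auto simp: distrib_left lookup_add mult_single lookup_single when_def)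

lemma coef_mterm_times_eq_0:
  fixes q :: "'m::cancel_comm_monoid_add \<Rightarrow>\<^sub>0 'a::comm_ring_1"
  assumes "\<And>b. t \<noteq> a + b"
  shows "coef (mterm a c * q) t = 0"
  using assms
  by (induction q rule: mpoly_induct)
    (auto simp: distrib_left lookup_add mult_single lookup_single when_def)

lemma coef_Const_times [simp]: "coef (Const c * q) t = c * coef q t"
  using coef_mterm_times[of 0 c q t] by (simp add: Const_def)

text \<open>The index sets may exceed the supports, so that products of different pairs of polynomials
  can be compared over common index sets.\<close>

lemma coef_times:
  fixes p q :: "'m::cancel_comm_monoid_add \<Rightarrow>\<^sub>0 'a::comm_ring_1"
  assumes "finite A" "Poly_Mapping.keys p \<subseteq> A" "finite B" "Poly_Mapping.keys q \<subseteq> B"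
  shows "coef (p * q) t = (\<Sum>a\<in>A. \<Sum>b\<in>B. if a + b = t then coef p a * coef q b else 0)"
proof -
  have "p * q = (\<Sum>a\<in>A. mterm a (coef p a)) * (\<Sum>b\<in>B. mterm b (coef q b))"
    using mpoly_as_sum[OF assms(1,2)] mpoly_as_sum[OF assms(3,4)] by simp
  also have "\<dots> = (\<Sum>a\<in>A. \<Sum>b\<in>B. mterm (a + b) (coef p a * coef q b))"
    by (simp add: sum_product mult_single)
  finally show ?thesis
    by (simp add: lookup_sum lookup_single when_def)
qed

lemma coef_times_unique:
  fixes p q :: "'m::cancel_comm_monoid_add \<Rightarrow>\<^sub>0 'a::comm_ring_1"
  assumes "\<And>a b. a \<in> Poly_Mapping.keys p \<Longrightarrow> b \<in> Poly_Mapping.keys q \<Longrightarrow> a + b = t \<longleftrightarrow> a = k \<and> b = l"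
  shows "coef (p * q) t = coef p k * coef q l"
proof -
  have "coef (p * q) t = (\<Sum>a\<in>Poly_Mapping.keys p. \<Sum>b\<in>Poly_Mapping.keys q.
      if a = k then (if b = l then coef p a * coef q b else 0) else 0)"
    unfolding coef_times[OF finite_keys subset_refl finite_keys subset_refl]
    by (intro sum.cong refl) (auto simp: assms)
  also have "\<dots> = (\<Sum>a\<in>Poly_Mapping.keys p. if a = k then 
      (\<Sum>b\<in>Poly_Mapping.keys q. if b = l then coef p a * coef q b else 0) else 0)"
    by (intro sum.cong refl) auto
  also have "\<dots> = coef p k * coef q l"
    by (simp add: sum.delta in_keys_iff)
  finally show ?thesis .
qed

lemma Const_zero [simp]: "Const 0 = 0"
  by (simp add: Const_def)

lemma Const_one [simp]: "Const 1 = 1"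
  by (simp add: Const_def)

lemma Const_add: "Const (a + b) = Const a + Const b"
  by (simp add: Const_def single_add)

lemma Const_mult: "Const (a * b) = Const a * Const b"
  by (simp add: Const_def mult_single)

lemma Const_power: "Const (a ^ i) = Const a ^ i"
  by (induction i) (simp_all add: Const_mult)

lemma Const_sum: "Const (sum h A) = (\<Sum>i\<in>A. Const (h i))"
  by (induction A rule: infinite_finite_induct) (auto simp: Const_add)

lemma Const_eq_0_iff [simp]: "Const c = (0 :: ('b, 'a::comm_ring_1) mpoly) \<longleftrightarrow> c = 0"
proof
  assume "Const c = (0 :: ('b, 'a) mpoly)"
  then have "coef (Const c :: ('b, 'a) mpoly) 0 = 0" by (simp only: lookup_zero)
  then show "c = 0" by (simp add: Const_def)
qed simp

lemma exp_degree_superset: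
  "finite A \<Longrightarrow> Poly_Mapping.keys m \<subseteq> A \<Longrightarrow> exp_degree m = (\<Sum>v\<in>A. coef m v)"
  unfolding exp_degree_def by (rule sum.mono_neutral_left) (auto simp: in_keys_iff)

lemma exp_degree_add: "exp_degree (a + b) = exp_degree a + exp_degree b"
proof -
  let ?A = "Poly_Mapping.keys a \<union> Poly_Mapping.keys b"
  have "exp_degree (a + b) = (\<Sum>v\<in>?A. coef (a + b) v)"
    using keys_add[of a b] by (intro exp_degree_superset) auto
  also have "\<dots> = (\<Sum>v\<in>?A. coef a v) + (\<Sum>v\<in>?A. coef b v)"
    by (simp only: lookup_add sum.distrib)
  also have "\<dots> = exp_degree a + exp_degree b"
    using exp_degree_superset[of ?A a] exp_degree_superset[of ?A b] by simp
  finally show ?thesis .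
qed

lemma exp_degree_eq_0_iff: "exp_degree m = 0 \<longleftrightarrow> m = 0"
  by (auto simp: exp_degree_def simp flip: keys_eq_empty lookup_not_eq_zero_eq_in_keys)

lemma exp_degree_zero [simp]: "exp_degree 0 = 0"
  by (simp add: exp_degree_def)

lemma exp_degree_mterm [simp]: "exp_degree (mterm v j) = j"
  by (simp add: exp_degree_def)

lemma homogeneous_zero [simp]: "homogeneous d 0"
  by (simp add: homogeneous_def)

lemma homogeneous_Const [simp]: "homogeneous 0 (Const c)"
  by (simp add: homogeneous_def Const_def)

lemma homogeneous_Var [simp]: "homogeneous 1 (Var v)"
  by (simp add: homogeneous_def Var_def)

lemma homogeneous_one [simp]: "homogeneous 0 1"
  by (simp add: homogeneous_def)

lemma homogeneous_add: "homogeneous d p \<Longrightarrow> homogeneous d q \<Longrightarrow> homogeneous d (p + q)"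
  using keys_add[of p q] by (force simp: homogeneous_def)

lemma homogeneous_uminus: "homogeneous d p \<Longrightarrow> homogeneous d (- p)"
  by (simp add: homogeneous_def in_keys_iff)

lemma homogeneous_diff: "homogeneous d p \<Longrightarrow> homogeneous d q \<Longrightarrow> homogeneous d (p - q)"
  using homogeneous_add[of d p "- q"] homogeneous_uminus[of d q] by simp

lemma homogeneous_sum: "(\<And>i. i \<in> A \<Longrightarrow> homogeneous d (F i)) \<Longrightarrow> homogeneous d (sum F A)"
  by (induction A rule: infinite_finite_induct) (auto intro: homogeneous_add)

lemma homogeneous_mult:
  assumes "homogeneous d p" "homogeneous e q"
  shows "homogeneous (d + e) (p * q)"
  using assms keys_mult[of p q] by (force simp: homogeneous_def exp_degree_add)

lemma homogeneous_prod:
  "finite A \<Longrightarrow> (\<And>i. i \<in> A \<Longrightarrow> homogeneous (e i) (F i)) \<Longrightarrow> homogeneous (sum e A) (prod F A)"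
  by (induction rule: finite_induct) (auto intro: homogeneous_mult)

lemma exponent_add_eq_0_iff: "a + b = (0 :: 'v \<Rightarrow>\<^sub>0 nat) \<longleftrightarrow> a = 0 \<and> b = 0"
proof
  assume "a + b = 0"
  then have "exp_degree (a + b) = 0" by simp
  then show "a = 0 \<and> b = 0" by (simp add: exp_degree_add exp_degree_eq_0_iff)
qed simp

text \<open>The constant coefficient is multiplicative, because exponents are natural numbers and add up to 0
  only if they vanish.\<close>

lemma constant_coef_of_unit:
  fixes c :: "('v, 'a::idom) mpoly"
  assumes "c dvd 1"
  shows "coef c 0 \<noteq> 0"
proof -
  from assms obtain p where p: "1 = c * p" by (elim dvdE)
  have "coef (c * p) 0 = coef c 0 * coef p 0"
    by (rule coef_times_unique) (rule exponent_add_eq_0_iff)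
  then have "1 = coef c 0 * coef p 0" by (simp flip: p)
  then show ?thesis by auto
qed

text \<open>The constant term of \<open>c\<close> contributes a nonzero part of degree \<open>n\<close> to \<open>c * d\<close>, and no other term of \<open>c\<close>
  can cancel it.\<close>

lemma homogeneous_multiple_degree:
  fixes c d :: "('v, 'a::idom) mpoly"
  assumes "homogeneous n d" "d \<noteq> 0" "homogeneous m (c * d)" "coef c 0 \<noteq> 0"
  shows "m = n"
proof -
  obtain e where e: "e \<in> Poly_Mapping.keys d" using assms(2) by (metis all_not_in_conv keys_eq_empty)
  then have "exp_degree e = n" using assms(1) by (simp add: homogeneous_def)
  have "coef (c * d) e = coef c 0 * coef d e"
  proof (rule coef_times_unique)
    fix a b
    assume "b \<in> Poly_Mapping.keys d"
    then have "exp_degree b = n" using assms(1) by (simp add: homogeneous_def)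
    then have "exp_degree a = 0" if "a + b = e"
      using exp_degree_add[of a b] \<open>exp_degree e = n\<close> that by simp
    then show "a + b = e \<longleftrightarrow> a = 0 \<and> b = e" by (auto simp: exp_degree_eq_0_iff)
  qed
  then have "e \<in> Poly_Mapping.keys (c * d)" using assms(4) e by (simp add: in_keys_iff)
  then show ?thesis using assms(3) \<open>exp_degree e = n\<close> by (simp add: homogeneous_def)
qed

lemma total_degree_homogeneous:
  assumes "homogeneous d p" "p \<noteq> 0"
  shows "total_degree p = d"
proof -
  have "Poly_Mapping.keys p \<noteq> {}" using assms by auto
  then have "exp_degree ` Poly_Mapping.keys p = {d}"
    using assms by (auto simp: homogeneous_def image_iff ex_in_conv)
  then show ?thesis by (simp add: total_degree_def)
qed

section \<open>Division by a variable and Koszul relations\<close>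

definition free_of :: "'v \<Rightarrow> ('v, 'a::comm_ring_1) mpoly \<Rightarrow> bool" where
  "free_of v p \<longleftrightarrow> (\<forall>t\<in>Poly_Mapping.keys p. coef t v = 0)"

text \<open>A strict bound makes \<open>degree_below 0\<close> say that the polynomial is zero, which is where the induction
  on the degree in \<open>T\<close> starts, and lets division by a variable lower the bound by one even for constants.\<close>

definition degree_below :: "nat \<Rightarrow> ('v, 'a::comm_ring_1) mpoly \<Rightarrow> bool" where
  "degree_below e p \<longleftrightarrow> (\<forall>t\<in>Poly_Mapping.keys p. exp_degree t < e)"

lemma free_of_add: "free_of v p \<Longrightarrow> free_of v q \<Longrightarrow> free_of v (p + q)"
  using keys_add[of p q] by (force simp: free_of_def)

lemma free_of_mult: "free_of v p \<Longrightarrow> free_of v q \<Longrightarrow> free_of v (p * q)"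
  using keys_mult[of p q] by (force simp: free_of_def lookup_add)

lemma free_of_Var: "v \<noteq> w \<Longrightarrow> free_of v (Var w)"
  by (simp add: free_of_def Var_def lookup_single)

lemma degree_below_uminus [simp]: "degree_below e (- p) \<longleftrightarrow> degree_below e p"
  by (simp add: degree_below_def in_keys_iff)

lemma degree_below_add: "degree_below e p \<Longrightarrow> degree_below e q \<Longrightarrow> degree_below e (p + q)"
  using keys_add[of p q] by (force simp: degree_below_def)

lemma degree_below_diff: "degree_below e p \<Longrightarrow> degree_below e q \<Longrightarrow> degree_below e (p - q)"
  using degree_below_add[of e p "- q"] by simp

lemma degree_below_0: "degree_below 0 p \<Longrightarrow> p = 0"
  by (auto simp: degree_below_def simp flip: keys_eq_empty)

lemma degree_below_exists: "\<exists>e. degree_below e p"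
proof
  show "degree_below (Suc (Max (insert 0 (exp_degree ` Poly_Mapping.keys p)))) p"
    by (auto simp: degree_below_def less_Suc_eq_le)
qed

lemma degree_below_mono: "degree_below e p \<Longrightarrow> e \<le> e' \<Longrightarrow> degree_below e' p"
  by (auto simp: degree_below_def)

lemma degree_below_Var_mult: "degree_below e p \<Longrightarrow> degree_below (Suc e) (Var v * p)"
  using keys_mult[of "Var v" p] by (force simp: degree_below_def Var_def exp_degree_add)

lemma degree_below_Const_mult: "degree_below e p \<Longrightarrow> degree_below e (Const c * p)"
  by (auto simp: degree_below_def in_keys_iff)

lemma coef_Var_times: "coef (Var v * q) (mterm v 1 + t) = coef q t"
  by (simp add: Var_def coef_mterm_times)

lemma coef_Var_times_free:
  assumes "coef t v = 0"
  shows "coef (Var v * q) t = 0"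
  unfolding Var_def using assms
  by (intro coef_mterm_times_eq_0) (auto simp: lookup_add)

lemma exponent_split:
  fixes t :: "'v \<Rightarrow>\<^sub>0 nat"
  assumes "coef t v \<noteq> 0"
  obtains u where "t = mterm v 1 + u"
proof
  show "t = mterm v 1 + (t - mterm v 1)"
    using assms by (intro poly_mapping_eqI) (auto simp: lookup_add lookup_minus lookup_single when_def)
qed

text \<open>The remainder consists of those terms of \<open>p\<close> that do not contain \<open>v\<close>, and the quotient comes from the others by
  lowering the exponent of \<open>v\<close>. This is why the bound on the degree drops for the quotient, and why the remainder
  lacks every variable that \<open>p\<close> lacks.\<close>

lemma divide_by_Var:
  obtains q r where "p = Var v * q + r" "free_of v r"
    "\<And>e. degree_below (Suc e) p \<Longrightarrow> degree_below e q"
    "\<And>w. free_of w p \<Longrightarrow> free_of w r"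
proof
  define q where "q = Poly_Mapping.map_key (\<lambda>t. mterm v 1 + t) p"
  define r where "r = p - Var v * q"
  have q: "coef q t = coef p (mterm v 1 + t)" for t
    unfolding q_def by (subst map_key.rep_eq) (auto simp: inj_def)
  have r: "coef r t = (if coef t v = 0 then coef p t else 0)" for t
  proof (cases "coef t v = 0")
    case True
    then show ?thesis by (simp add: r_def lookup_minus coef_Var_times_free)
  next
    case False
    then obtain u where u: "t = mterm v 1 + u" by (rule exponent_split)
    have "coef r t = 0"
      unfolding u r_def lookup_minus coef_Var_times q by simp
    with False show ?thesis by simp
  qed
  show "p = Var v * q + r" by (simp add: r_def)
  show "free_of v r" by (auto simp: free_of_def in_keys_iff r split: if_splits)
  show "degree_below e q" if "degree_below (Suc e) p" for e
    unfolding degree_below_def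
  proof
    fix t
    assume "t \<in> Poly_Mapping.keys q"
    then have "mterm v 1 + t \<in> Poly_Mapping.keys p" by (simp add: in_keys_iff q)
    then have "exp_degree (mterm v 1 + t) < Suc e" using that by (simp add: degree_below_def)
    then show "exp_degree t < e" by (simp add: exp_degree_add)
  qed
  show "free_of w r" if "free_of w p" for w
    using that by (auto simp: free_of_def in_keys_iff r split: if_splits)
qed

lemma Var_division_unique:
  fixes q r :: "('v, 'a::comm_ring_1) mpoly"
  assumes "Var v * q + r = 0" "free_of v r"
  shows "q = 0" "r = 0"
proof -
  show "q = 0"
  proof (rule poly_mapping_eqI)
    fix t :: "'v \<Rightarrow>\<^sub>0 nat"
    have "coef (mterm v 1 + t) v \<noteq> 0"
      by (simp add: lookup_add)
    then have "coef r (mterm v 1 + t) = 0"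
      using assms(2) unfolding free_of_def Ball_def in_keys_iff by metis
    moreover have "coef (Var v * q + r) (mterm v 1 + t) = 0" by (simp add: assms(1))
    ultimately show "coef q t = coef 0 t" unfolding lookup_add coef_Var_times by simp
  qed
  then show "r = 0" using assms(1) by simp
qed

text \<open>Exactness of the Koszul complex of three variables at its middle term, with control of the degree.
  Dividing \<open>c1\<close> by \<open>v\<close> and then by \<open>w\<close> leaves a part \<open>r'\<close> that contains neither variable; since
  \<open>Var u * r'\<close> must be cancelled by multiples of \<open>Var v\<close> and \<open>Var w\<close>, it vanishes. The quotients are two of the
  three coefficients, and the third appears when the resulting relation between \<open>v\<close> and \<open>w\<close> is divided by \<open>v\<close>.\<close>

lemma koszul_three_variables:
  fixes c1 c2 c3 :: "('v, 'a::comm_ring_1) mpoly"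
  assumes uvw: "u \<noteq> v" "u \<noteq> w" "v \<noteq> w"
    and eq: "Var u * c1 + Var v * c2 + Var w * c3 = 0"
    and deg: "degree_below (Suc e) c1" "degree_below (Suc e) c2" "degree_below (Suc e) c3"
  obtains a1 a2 a3 where "degree_below e a1" "degree_below e a2" "degree_below e a3"
    "c1 = Var v * a3 - Var w * a2" "c2 = Var w * a1 - Var u * a3" "c3 = Var u * a2 - Var v * a1"
proof -
  obtain p r where p: "c1 = Var v * p + r" "free_of v r" "degree_below e p"
    using deg(1) by (metis divide_by_Var)
  have degr: "degree_below (Suc e) r"
    using degree_below_diff[OF deg(1) degree_below_Var_mult[OF p(3), of v]] p(1) by simp
  obtain q r' where q: "r = Var w * q + r'" "free_of w r'" "degree_below e q" "free_of v r'"
    using degr p(2) by (metis divide_by_Var)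
  have "degree_below (Suc e) (c3 + Var u * q)"
    by (intro degree_below_add deg degree_below_Var_mult q)
  then obtain z z' where z: "c3 + Var u * q = Var v * z + z'" "free_of v z'" "degree_below e z"
    by (metis divide_by_Var)
  have eq': "Var v * (c2 + Var u * p + Var w * z) + (Var w * z' + Var u * r') = 0"
  proof -
    have "Var v * (c2 + Var u * p + Var w * z) + (Var w * z' + Var u * r')
      = Var v * c2 + Var u * (Var v * p + r') + Var w * (Var v * z + z')"
      by (simp add: algebra_simps)
    also have "\<dots> = Var v * c2 + Var u * (Var v * p + r') + Var w * (c3 + Var u * q)"
      by (simp add: z(1))
    also have "\<dots> = Var u * c1 + Var v * c2 + Var w * c3"
      by (simp add: p(1) q(1) algebra_simps)
    finally show ?thesis using eq by simp
  qed
  have "free_of v (Var w * z' + Var u * r')"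
    by (intro free_of_add free_of_mult free_of_Var z q) (use uvw in auto)
  note 1 = Var_division_unique[OF eq' this]
  have "free_of w (Var u * r')"
    by (intro free_of_mult free_of_Var q) (use uvw in auto)
  note 2 = Var_division_unique[OF 1(2) this]
  have "Var u * r' + 0 = 0" using 2(2) by simp
  then have "r' = 0" by (rule Var_division_unique) (simp add: free_of_def)
  show thesis
  proof
    show "degree_below e (- z)" "degree_below e (- q)" "degree_below e p" using z q p by auto
    show "c1 = Var v * p - Var w * - q" by (simp add: p(1) q(1) \<open>r' = 0\<close>)
    show "c2 = Var w * - z - Var u * p" using 1(1) by (simp add: algebra_simps eq_neg_iff_add_eq_0)
    show "c3 = Var u * - q - Var v * - z" using z(1) 2(1) by (simp add: algebra_simps)
  qed
qed

section \<open>Vectors parallel to a vector of depth two\<close>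

lemma Var_power: "Var v ^ i = mterm (mterm v i) 1"
  by (induction i) (simp_all add: Var_def mult_single flip: single_add)

lemma Var_power_nonzero: "Var v ^ M \<noteq> (0 :: ('v, 'a::comm_ring_1) mpoly)"
proof -
  have "coef (Var v ^ M :: ('v, 'a) mpoly) (mterm v M) \<noteq> 0"
    by (simp only: Var_power lookup_single_eq one_neq_zero not_False_eq_True)
  then show ?thesis by (metis lookup_zero)
qed

lemma Var_dvd_Var_times:
  assumes "u \<noteq> v" "Var u dvd Var v * q"
  shows "Var u dvd q"
proof -
  from assms(2) obtain p where p: "Var v * q = Var u * p" by (elim dvdE)
  obtain z r where z: "q = Var u * z + r" "free_of u r" by (metis divide_by_Var)
  have "Var u * (Var v * z - p) + Var v * r = 0"
    using p by (simp add: z algebra_simps)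
  moreover have "free_of u (Var v * r)" using assms(1) by (intro free_of_mult free_of_Var z)
  ultimately have "Var v * r + 0 = 0" using Var_division_unique(2) by fastforce
  then have "r = 0" by (rule Var_division_unique) (simp add: free_of_def)
  then show ?thesis by (simp add: z)
qed

lemma Var_power_dvd_Var_times:
  assumes "u \<noteq> v" "Var u ^ M dvd Var v * q"
  shows "Var u ^ M dvd q"
  using assms(2)
proof (induction M arbitrary: q)
  case (Suc M)
  have "Var u dvd Var v * q" using Suc.prems by (auto intro: dvd_mult_left)
  then have "Var u dvd q" by (rule Var_dvd_Var_times[OF assms(1)])
  then obtain q' where q': "q = Var u * q'" by (elim dvdE)
  from Suc.prems obtain c where "Var v * q = Var u ^ Suc M * c" by (elim dvdE)
  then have "Var u * (Var v * q') = Var u * (Var u ^ M * c)"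
    by (simp only: q' power_Suc mult.assoc mult.left_commute[of "Var u" "Var v"])
  then have "Var u * (Var v * q' - Var u ^ M * c) + 0 = 0" by (simp add: right_diff_distrib)
  then have "Var v * q' - Var u ^ M * c = 0"
    by (rule Var_division_unique) (simp add: free_of_def)
  then have "Var u ^ M dvd Var v * q'" by simp
  then have "Var u ^ M dvd q'" by (rule Suc.IH)
  then show ?case by (simp add: q' mult_dvd_mono)
qed simp

text \<open>Powers of two different variables form a regular sequence.\<close>

lemma Var_power_dvd_Var_power_times:
  assumes "u \<noteq> v" "Var u ^ M dvd Var v ^ K * q"
  shows "Var u ^ M dvd q"
  using assms(2)
proof (induction K arbitrary: q)
  case (Suc K)
  then have "Var u ^ M dvd Var v * (Var v ^ K * q)" by (simp only: power_Suc mult.assoc)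
  then have "Var u ^ M dvd Var v ^ K * q" by (rule Var_power_dvd_Var_times[OF assms(1)])
  then show ?case by (rule Suc.IH)
qed simp

lemma Const_dvd:
  fixes p :: "('v, 'a::comm_ring_1) mpoly"
  assumes "\<And>t. c dvd coef p t"
  shows "Const c dvd p"
proof -
  define h where "h a = (SOME b. a = c * b)" for a
  have h: "c * h (coef p t) = coef p t" for t
  proof -
    from assms[of t] obtain b where "coef p t = c * b" by (elim dvdE)
    then have "coef p t = c * (SOME b. coef p t = c * b)" by (rule someI)
    then show ?thesis by (simp add: h_def)
  qed
  have "p = Const c * Poly_Mapping.map h p"
    by (rule poly_mapping_eqI) (auto simp: map.rep_eq when_def h in_keys_iff)
  then show ?thesis by (metis dvd_triv_left)
qed

text \<open>The assumptions on \<open>\<alpha>\<close> and \<open>\<beta>\<close> say that they form a regular sequence in the ideal of \<open>d1\<close>, \<open>d2\<close>, \<open>d3\<close>.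
  Combining the parallelism relations gives \<open>\<alpha> z = za d\<close> and \<open>\<beta> z = zb d\<close>, so \<open>\<beta> za = \<alpha> zb\<close>. By regularity
  \<open>\<alpha>\<close> divides \<open>za\<close>, and the quotient is the factor.\<close>

lemma parallel_is_multiple:
  fixes d1 d2 d3 z1 z2 z3 \<alpha> \<beta> :: "'a::idom"
  assumes \<alpha>: "\<alpha> = a1 * d1 + a2 * d2 + a3 * d3" "\<alpha> \<noteq> 0"
    and \<beta>: "\<beta> = b1 * d1 + b2 * d2 + b3 * d3"
    and regular: "\<And>q. \<alpha> dvd \<beta> * q \<Longrightarrow> \<alpha> dvd q"
    and parallel: "z1 * d2 = z2 * d1" "z1 * d3 = z3 * d1" "z2 * d3 = z3 * d2"
  obtains q where "z1 = q * d1" "z2 = q * d2" "z3 = q * d3"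
proof -
  define za where "za = a1 * z1 + a2 * z2 + a3 * z3"
  define zb where "zb = b1 * z1 + b2 * z2 + b3 * z3"
  have scale: "(x1 * d1 + x2 * d2 + x3 * d3) * z = (x1 * z1 + x2 * z2 + x3 * z3) * e"
    if "z * d1 = z1 * e" "z * d2 = z2 * e" "z * d3 = z3 * e" for x1 x2 x3 z e
  proof -
    have "(x1 * d1 + x2 * d2 + x3 * d3) * z = x1 * (z * d1) + x2 * (z * d2) + x3 * (z * d3)"
      by (simp add: algebra_simps)
    also have "\<dots> = x1 * (z1 * e) + x2 * (z2 * e) + x3 * (z3 * e)"
      by (simp only: that)
    finally show ?thesis by (simp add: algebra_simps)
  qed
  have a: "\<alpha> * z1 = za * d1" "\<alpha> * z2 = za * d2" "\<alpha> * z3 = za * d3"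
    unfolding \<alpha>(1) za_def by (rule scale; simp add: parallel)+
  have b: "\<beta> * z1 = zb * d1" "\<beta> * z2 = zb * d2" "\<beta> * z3 = zb * d3"
    unfolding \<beta> zb_def by (rule scale; simp add: parallel)+
  have "\<beta> * za * d1 = \<alpha> * zb * d1" "\<beta> * za * d2 = \<alpha> * zb * d2" "\<beta> * za * d3 = \<alpha> * zb * d3"
    unfolding mult.assoc by (simp_all only: mult.left_commute flip: a b)
  moreover have "d1 \<noteq> 0 \<or> d2 \<noteq> 0 \<or> d3 \<noteq> 0" using \<alpha> by auto
  ultimately have "\<beta> * za = \<alpha> * zb" using mult_right_cancel by blast
  then have "\<alpha> dvd \<beta> * za" by simp
  then have "\<alpha> dvd za" by (rule regular)
  then obtain q where q: "za = \<alpha> * q" by (elim dvdE)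
  have "z1 = q * d1" "z2 = q * d2" "z3 = q * d3"
    using a \<alpha>(2) unfolding q mult.assoc by (simp_all only: mult_left_cancel not_False_eq_True)
  then show thesis by (rule that)
qed

section \<open>Coordinates with respect to the monomials in x and y\<close>

lemma coef_kT_to_S [simp]: "coef (kT_to_S p) t = Const (coef p t)"
  by (simp add: kT_to_S_def map.rep_eq when_def)

lemma keys_kT_to_S: "Poly_Mapping.keys (kT_to_S p) = Poly_Mapping.keys p"
  by (auto simp: in_keys_iff)

lemma kT_to_S_zero [simp]: "kT_to_S 0 = 0"
  by (rule poly_mapping_eqI) simp

lemma kT_to_S_add: "kT_to_S (p + q) = kT_to_S p + kT_to_S q"
  by (rule poly_mapping_eqI) (simp add: lookup_add Const_add)

lemma kT_to_S_sum: "kT_to_S (sum h A) = (\<Sum>i\<in>A. kT_to_S (h i))"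
  by (induction A rule: infinite_finite_induct) (auto simp: kT_to_S_add)

lemma kT_to_S_mult: "kT_to_S (p * q) = kT_to_S p * kT_to_S q"
proof (rule poly_mapping_eqI)
  fix t
  show "coef (kT_to_S (p * q)) t = coef (kT_to_S p * kT_to_S q) t"
    unfolding coef_kT_to_S
      coef_times[of "Poly_Mapping.keys p" p "Poly_Mapping.keys q" q, OF finite_keys subset_refl finite_keys subset_refl]
      coef_times[of "Poly_Mapping.keys p" "kT_to_S p" "Poly_Mapping.keys q" "kT_to_S q",
        OF finite_keys equalityD1[OF keys_kT_to_S] finite_keys equalityD1[OF keys_kT_to_S]]
      Const_sum
    by (intro sum.cong refl) (simp add: Const_mult)
qed

abbreviation xy_exp :: "nat \<Rightarrow> nat \<Rightarrow> xyvar \<Rightarrow>\<^sub>0 nat" where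
  "xy_exp a b \<equiv> mterm X a + mterm Y b"

lemma xy_exp_of_coefs: "e = xy_exp (coef e X) (coef e Y)"
proof (rule poly_mapping_eqI)
  fix v
  show "coef e v = coef (xy_exp (coef e X) (coef e Y)) v"
    by (cases v) (simp_all add: lookup_add lookup_single)
qed

lemma xy_exp_eq_iff [simp]: "xy_exp a b = xy_exp c d \<longleftrightarrow> a = c \<and> b = d"
proof
  assume "xy_exp a b = xy_exp c d"
  then have "coef (xy_exp a b) v = coef (xy_exp c d) v" for v by simp
  from this[of X] this[of Y] show "a = c \<and> b = d" by (simp add: lookup_add lookup_single)
qed simp

lemma exp_degree_xy_exp: "exp_degree e = coef e X + coef e Y"
  by (subst xy_exp_of_coefs[of e]) (simp add: exp_degree_add)

lemma xy_monomial_Const: "xS ^ a * yS ^ b = Const (mterm (xy_exp a b) 1)"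
  by (simp add: xS_def yS_def Var_power mult_single flip: Const_power Const_mult)

lemma S_term: "mterm t (mterm (xy_exp a b) c) = kT_to_S (mterm t c) * (xS ^ a * yS ^ b)"
proof (rule poly_mapping_eqI)
  fix u
  show "coef (mterm t (mterm (xy_exp a b) c)) u = coef (kT_to_S (mterm t c) * (xS ^ a * yS ^ b)) u"
    unfolding xy_monomial_Const mult.commute[of "kT_to_S _"] coef_Const_times coef_kT_to_S
    by (simp add: lookup_single when_def Const_def mult_single)
qed

text \<open>The monomials in \<open>x\<close> and \<open>y\<close> span \<open>S\<close> over \<open>k[T]\<close>, so a statement that is additive in \<open>p\<close> needs to be
  checked only for multiples of these monomials.\<close>

lemma S_induct [case_names zero add]:
  fixes p :: "'k::field S"
  assumes "P 0" and "\<And>c a b p. P p \<Longrightarrow> P (kT_to_S c * (xS ^ a * yS ^ b) + p)"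
  shows "P p"
proof (induction p rule: mpoly_induct)
  case (add t \<rho> p)
  show ?case
  proof (induction \<rho> rule: mpoly_induct)
    case (add e c \<rho>)
    have "mterm t (mterm e c + \<rho>) + p = kT_to_S (mterm t c) * (xS ^ coef e X * yS ^ coef e Y) + (mterm t \<rho> + p)"
      by (subst xy_exp_of_coefs[of e]) (simp add: single_add add.assoc S_term)
    then show ?case using assms(2)[OF add] by (simp only:)
  qed (use add in simp)
qed (fact assms(1))

text \<open>The bigrading with the degree in \<open>T\<close> forgotten: unlike the bihomogeneous elements, the forms of a given
  degree in \<open>x\<close> and \<open>y\<close> are a module over \<open>k[T]\<close>.\<close>

definition xy_form :: "nat \<Rightarrow> 'k::field S \<Rightarrow> bool" where
  "xy_form d p \<longleftrightarrow> (\<forall>t. homogeneous d (coef p t))"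

lemma bihomogeneous_xy_form: "bihomogeneous d e p \<Longrightarrow> xy_form d p"
  by (metis bihomogeneous_def xy_form_def homogeneous_zero in_keys_iff)

lemma xy_form_zero [simp]: "xy_form d 0"
  by (simp add: xy_form_def)

lemma xy_form_add: "xy_form d p \<Longrightarrow> xy_form d q \<Longrightarrow> xy_form d (p + q)"
  by (simp add: xy_form_def lookup_add homogeneous_add)

lemma xy_form_diff: "xy_form d p \<Longrightarrow> xy_form d q \<Longrightarrow> xy_form d (p - q)"
  by (simp add: xy_form_def lookup_minus homogeneous_diff)

lemma xy_form_sum: "(\<And>i. i \<in> A \<Longrightarrow> xy_form d (h i)) \<Longrightarrow> xy_form d (sum h A)"
  by (induction A rule: infinite_finite_induct) (auto intro: xy_form_add)

lemma xy_form_mult: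
  assumes "xy_form d p" "xy_form e q"
  shows "xy_form (d + e) (p * q)"
  unfolding xy_form_def coef_times[OF finite_keys subset_refl finite_keys subset_refl]
  using assms by (auto intro!: homogeneous_sum homogeneous_mult simp: xy_form_def)

lemma xy_form_kT [simp]: "xy_form 0 (kT_to_S c)"
  by (simp add: xy_form_def)

lemma xy_form_Const: "homogeneous d c \<Longrightarrow> xy_form d (Const c)"
  by (simp add: xy_form_def Const_def lookup_single when_def)

lemma xy_form_Var [simp]: "xy_form 0 (Var t)"
  by (simp add: xy_form_def Var_def lookup_single when_def)

lemma xy_form_monomial [simp]: "xy_form (a + b) (xS ^ a * yS ^ b)"
  unfolding xy_monomial_Const
  by (intro xy_form_Const) (simp add: homogeneous_def exp_degree_add)

text \<open>The coefficient, in \<open>k[T]\<close>, of the monomial with index \<open>i\<close> in \<open>xy_monomials m\<close>. These monomials have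
  degree \<open>m - 1\<close>; on elements of other degrees the coordinates vanish, so they also extract the part of
  degree \<open>m - 1\<close> of an arbitrary element.\<close>

definition xy_coord :: "nat \<Rightarrow> nat \<Rightarrow> 'k::field S \<Rightarrow> 'k kT" where
  "xy_coord m i p = Poly_Mapping.map (\<lambda>\<rho>. coef \<rho> (xy_exp (m - 1 - i) i)) p"

lemma coef_xy_coord: "coef (xy_coord m i p) t = coef (coef p t) (xy_exp (m - 1 - i) i)"
  by (simp add: xy_coord_def map.rep_eq when_def)

lemma xy_coord_zero [simp]: "xy_coord m i 0 = 0"
  by (rule poly_mapping_eqI) (simp add: coef_xy_coord)

lemma xy_coord_add: "xy_coord m i (p + q) = xy_coord m i p + xy_coord m i q"
  by (rule poly_mapping_eqI) (simp add: coef_xy_coord lookup_add)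

lemma xy_coord_sum: "xy_coord m i (sum h A) = (\<Sum>j\<in>A. xy_coord m i (h j))"
  by (induction A rule: infinite_finite_induct) (auto simp: xy_coord_add)

lemma xy_coord_kT_times: "xy_coord m i (kT_to_S c * p) = c * xy_coord m i p"
proof (rule poly_mapping_eqI)
  fix t
  have "Poly_Mapping.keys (xy_coord m i p) \<subseteq> Poly_Mapping.keys p"
    by (auto simp: in_keys_iff coef_xy_coord)
  note [simp] = coef_times[OF finite_keys subset_refl finite_keys this, of c t]
    coef_times[OF finite_keys equalityD1[OF keys_kT_to_S] finite_keys subset_refl, of c p t]
  show "coef (xy_coord m i (kT_to_S c * p)) t = coef (c * xy_coord m i p) t"
    by (auto simp: coef_xy_coord lookup_sum intro!: sum.cong)
qed

lemma xy_coord_other_degree: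
  assumes "xy_form d p" "d \<noteq> m - 1" "i < m"
  shows "xy_coord m i p = 0"
proof (rule poly_mapping_eqI)
  fix t
  have "exp_degree (xy_exp (m - 1 - i) i) \<noteq> d" using assms by (simp add: exp_degree_add)
  moreover have "exp_degree e = d" if "coef (coef p t) e \<noteq> 0" for e
    using assms(1) that by (auto simp: xy_form_def homogeneous_def in_keys_iff)
  ultimately show "coef (xy_coord m i p) t = coef 0 t"
    unfolding coef_xy_coord by fastforce
qed

lemma length_xy_monomials [simp]: "length (xy_monomials m) = m"
  by (simp add: xy_monomials_def)

lemma nth_xy_monomials [simp]: "i < m \<Longrightarrow> xy_monomials m ! i = xS ^ (m - 1 - i) * yS ^ i"
  by (simp add: xy_monomials_def)

lemma xy_coord_combination:
  assumes "i < m"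
  shows "xy_coord m i (\<Sum>j<m. xy_monomials m ! j * kT_to_S (b j)) = b i"
proof (rule poly_mapping_eqI)
  fix t
  have "coef (xy_coord m i (\<Sum>j<m. xy_monomials m ! j * kT_to_S (b j))) t
    = (\<Sum>j<m. coef (mterm (xy_exp (m - 1 - j) j) (coef (b j) t)) (xy_exp (m - 1 - i) i))"
    unfolding coef_xy_coord lookup_sum
    by (intro sum.cong refl) (simp add: xy_monomial_Const del: One_nat_def, simp add: Const_def mult_single)
  also have "\<dots> = (\<Sum>j<m. if j = i then coef (b j) t else 0)"
    by (intro sum.cong refl) (auto simp: lookup_single when_def)
  finally show "coef (xy_coord m i (\<Sum>j<m. xy_monomials m ! j * kT_to_S (b j))) t = coef (b i) t"
    using assms by simp
qed

lemma xy_form_expand: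
  assumes "xy_form (m - 1) p" "0 < m"
  shows "p = (\<Sum>j<m. xy_monomials m ! j * kT_to_S (xy_coord m j p))"
proof (intro poly_mapping_eqI)
  fix t e
  let ?q = "\<Sum>j<m. xy_monomials m ! j * kT_to_S (xy_coord m j p)"
  have q: "xy_form (m - 1) ?q"
  proof (intro xy_form_sum)
    fix j assume "j \<in> {..<m}"
    then show "xy_form (m - 1) (xy_monomials m ! j * kT_to_S (xy_coord m j p))"
      using xy_form_mult[OF xy_form_monomial[of "m - 1 - j" j] xy_form_kT] by simp
  qed
  show "coef (coef p t) e = coef (coef ?q t) e"
  proof (cases "exp_degree e = m - 1")
    case True
    define i where "i = coef e Y"
    have i: "e = xy_exp (m - 1 - i) i" "i < m"
      using True xy_exp_of_coefs[of e] assms(2) unfolding exp_degree_xy_exp i_def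
      by (metis add_diff_cancel_right', linarith)
    have "xy_coord m i ?q = xy_coord m i p" by (rule xy_coord_combination[OF i(2)])
    then have "coef (xy_coord m i p) t = coef (xy_coord m i ?q) t" by (simp only:)
    then show ?thesis unfolding coef_xy_coord i(1)[symmetric] .
  next
    case False
    then have "coef (coef p' t) e = 0" if "xy_form (m - 1) p'" for p'
      using that unfolding xy_form_def homogeneous_def in_keys_iff Ball_def by metis
    from this[OF assms(1)] this[OF q] show ?thesis by (simp only:)
  qed
qed

text \<open>Write \<open>T\<close> for the vector of the three variables. By the Koszul relations \<open>w = T \<times> a\<close> for some vector \<open>a\<close>
  of smaller degree in the variables. The vector \<open>a \<times> d\<close> is again orthogonal to \<open>T\<close> and to \<open>d\<close>, so by
  induction on that degree \<open>a \<times> d = q (T \<times> d)\<close>. This says that \<open>a - q T\<close> is parallel to \<open>d\<close>, hence equal to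
  \<open>p d\<close>, and therefore \<open>w = T \<times> a = p (T \<times> d)\<close>.\<close>

lemma orthogonal_to_variables_and_constants:
  fixes w1 w2 w3 :: "('v, 'a::comm_ring_1) mpoly"
  assumes uvw: "u \<noteq> v" "u \<noteq> w" "v \<noteq> w"
    and grade_two: "\<And>z1 z2 z3 :: ('v, 'a) mpoly. z1 * Const d2 = z2 * Const d1 \<Longrightarrow>
      z1 * Const d3 = z3 * Const d1 \<Longrightarrow> z2 * Const d3 = z3 * Const d2 \<Longrightarrow>
      \<exists>q. z1 = q * Const d1 \<and> z2 = q * Const d2 \<and> z3 = q * Const d3"
    and "Var u * w1 + Var v * w2 + Var w * w3 = 0"
    and "Const d1 * w1 + Const d2 * w2 + Const d3 * w3 = 0"
  shows "\<exists>q. w1 = q * (Var v * Const d3 - Var w * Const d2) \<and>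
             w2 = q * (Var w * Const d1 - Var u * Const d3) \<and>
             w3 = q * (Var u * Const d2 - Var v * Const d1)"
proof -
  obtain e where "degree_below e w1" "degree_below e w2" "degree_below e w3"
  proof -
    obtain e1 e2 e3 where e: "degree_below e1 w1" "degree_below e2 w2" "degree_below e3 w3"
      using degree_below_exists by metis
    show thesis
      by (rule that[of "max e1 (max e2 e3)"]; rule degree_below_mono, rule e, simp)
  qed
  then show ?thesis using assms(5,6)
  proof (induction e arbitrary: w1 w2 w3)
    case 0
    then show ?case by (intro exI[of _ 0]) (auto dest: degree_below_0)
  next
    case (Suc e)
    obtain a1 a2 a3 where a: "degree_below e a1" "degree_below e a2" "degree_below e a3"
      "w1 = Var v * a3 - Var w * a2" "w2 = Var w * a1 - Var u * a3" "w3 = Var u * a2 - Var v * a1"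
      using koszul_three_variables[OF uvw Suc.prems(4,1-3)] by metis
    have "\<exists>q. a2 * Const d3 - a3 * Const d2 = q * (Var v * Const d3 - Var w * Const d2) \<and>
             a3 * Const d1 - a1 * Const d3 = q * (Var w * Const d1 - Var u * Const d3) \<and>
             a1 * Const d2 - a2 * Const d1 = q * (Var u * Const d2 - Var v * Const d1)"
    proof (rule Suc.IH)
      show "degree_below e (a2 * Const d3 - a3 * Const d2)" "degree_below e (a3 * Const d1 - a1 * Const d3)"
        "degree_below e (a1 * Const d2 - a2 * Const d1)"
        unfolding mult.commute[of _ "Const _"]
        by (intro degree_below_diff degree_below_Const_mult a)+
      show "Var u * (a2 * Const d3 - a3 * Const d2) + Var v * (a3 * Const d1 - a1 * Const d3) +
          Var w * (a1 * Const d2 - a2 * Const d1) = 0"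
        using Suc.prems(5) unfolding a(4-6) by (simp add: algebra_simps)
      show "Const d1 * (a2 * Const d3 - a3 * Const d2) + Const d2 * (a3 * Const d1 - a1 * Const d3) +
          Const d3 * (a1 * Const d2 - a2 * Const d1) = 0"
        by (simp add: algebra_simps)
    qed
    then obtain q where q: 
      "a2 * Const d3 - a3 * Const d2 = q * (Var v * Const d3 - Var w * Const d2)"
      "a3 * Const d1 - a1 * Const d3 = q * (Var w * Const d1 - Var u * Const d3)"
      "a1 * Const d2 - a2 * Const d1 = q * (Var u * Const d2 - Var v * Const d1)"
      by blast
    have "(a1 - q * Var u) * Const d2 = (a2 - q * Var v) * Const d1"
      "(a1 - q * Var u) * Const d3 = (a3 - q * Var w) * Const d1"
      "(a2 - q * Var v) * Const d3 = (a3 - q * Var w) * Const d2"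
      using q by (simp_all add: algebra_simps)
    then obtain p where "a1 - q * Var u = p * Const d1" "a2 - q * Var v = p * Const d2"
      "a3 - q * Var w = p * Const d3"
      using grade_two by blast
    then have p: "a1 = p * Const d1 + q * Var u" "a2 = p * Const d2 + q * Var v"
      "a3 = p * Const d3 + q * Var w"
      by (metis diff_add_cancel)+
    show ?case
      unfolding a(4-6) p by (intro exI[of _ p]) (simp add: algebra_simps)
  qed
qed

text \<open>No term of \<open>q * z\<close> has degree below \<open>n\<close> in \<open>x\<close> and \<open>y\<close>.\<close>

lemma multiple_of_high_form_eq_0:
  assumes "xy_form e (q * z)" "xy_form n z" "e < n"
  shows "q * z = 0"
proof -
  have "xy_coord (Suc e) i (q * z) = 0" if "i < Suc e" for i
  proof (induction q rule: S_induct)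
    case (add c a b p)
    have "xy_form (a + b + n) (xS ^ a * yS ^ b * z)" by (intro xy_form_mult assms xy_form_monomial)
    then have "xy_coord (Suc e) i (xS ^ a * yS ^ b * z) = 0"
      by (rule xy_coord_other_degree) (use assms(3) that in auto)
    then show ?case using add by (simp add: distrib_right xy_coord_add xy_coord_kT_times mult.assoc)
  qed simp
  then show ?thesis using xy_form_expand[of "Suc e" "q * z"] assms(1) by simp
qed

section \<open>Relations between the two forms\<close>

text \<open>The complex \<open>0 \<rightarrow> R^2 \<rightarrow> R^3 \<rightarrow> R\<close> with the columns \<open>a\<close>, \<open>b\<close> and the row \<open>d\<close> is exact except at its right end,
  and the ideal of \<open>d\<close> contains powers of \<open>x\<close> and of \<open>y\<close>.\<close>

locale rank_two_syzygies =
  fixes d1 d2 d3 a1 a2 a3 b1 b2 b3 :: "'k::field R"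
  assumes complex: "d1 * a1 + d2 * a2 + d3 * a3 = 0" "d1 * b1 + d2 * b2 + d3 * b3 = 0"
    and exact: "\<And>w1 w2 w3. d1 * w1 + d2 * w2 + d3 * w3 = 0 \<Longrightarrow>
      \<exists>\<alpha> \<beta>. w1 = a1 * \<alpha> + b1 * \<beta> \<and> w2 = a2 * \<alpha> + b2 * \<beta> \<and> w3 = a3 * \<alpha> + b3 * \<beta>"
    and injective: "\<And>\<alpha> \<beta>. a1 * \<alpha> + b1 * \<beta> = 0 \<Longrightarrow> a2 * \<alpha> + b2 * \<beta> = 0 \<Longrightarrow> a3 * \<alpha> + b3 * \<beta> = 0 \<Longrightarrow>
      \<alpha> = 0 \<and> \<beta> = 0"
    and x_power: "\<exists>M p1 p2 p3. Var X ^ M = p1 * d1 + p2 * d2 + p3 * d3"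
    and y_power: "\<exists>K p1 p2 p3. Var Y ^ K = p1 * d1 + p2 * d2 + p3 * d3"
begin

lemma parallel_R:
  assumes "z1 * d2 = z2 * d1" "z1 * d3 = z3 * d1" "z2 * d3 = z3 * d2"
  obtains q where "z1 = q * d1" "z2 = q * d2" "z3 = q * d3"
proof -
  obtain M p1 p2 p3 where p: "Var X ^ M = p1 * d1 + p2 * d2 + p3 * d3" using x_power by blast
  obtain K p1' p2' p3' where p': "Var Y ^ K = p1' * d1 + p2' * d2 + p3' * d3" using y_power by blast
  have regular: "Var X ^ M dvd q" if "Var X ^ M dvd Var Y ^ K * q" for q :: "'k R"
    by (rule Var_power_dvd_Var_power_times[OF _ that]) simp
  show thesis by (rule parallel_is_multiple[OF p Var_power_nonzero p' regular assms]) (assumption | rule that)+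
qed

text \<open>The powers of \<open>x\<close> and \<open>y\<close> remain a regular sequence in \<open>S\<close>, because divisibility by an element of \<open>R\<close> is
  decided coefficient by coefficient.\<close>

lemma parallel_S:
  fixes z1 z2 z3 :: "'k S"
  assumes "z1 * Const d2 = z2 * Const d1" "z1 * Const d3 = z3 * Const d1" "z2 * Const d3 = z3 * Const d2"
  obtains q where "z1 = q * Const d1" "z2 = q * Const d2" "z3 = q * Const d3"
proof -
  obtain M p1 p2 p3 where "Var X ^ M = p1 * d1 + p2 * d2 + p3 * d3" using x_power by blast
  then have p: "Const (Var X ^ M) = Const p1 * Const d1 + Const p2 * Const d2 + Const p3 * Const d3"
    by (simp add: Const_add Const_mult)
  obtain K p1' p2' p3' where "Var Y ^ K = p1' * d1 + p2' * d2 + p3' * d3" using y_power by blast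
  then have p': "Const (Var Y ^ K) = Const p1' * Const d1 + Const p2' * Const d2 + Const p3' * Const d3"
    by (simp add: Const_add Const_mult)
  have regular: "Const (Var X ^ M) dvd q" if "Const (Var X ^ M) dvd Const (Var Y ^ K) * q" for q :: "'k S"
  proof (rule Const_dvd)
    fix t
    from that obtain p where "Const (Var Y ^ K) * q = Const (Var X ^ M) * p" by (elim dvdE)
    then have "coef (Const (Var Y ^ K) * q) t = coef (Const (Var X ^ M) * p) t" by simp
    then have "Var Y ^ K * coef q t = Var X ^ M * coef p t" by (simp only: coef_Const_times)
    then show "Var X ^ M dvd coef q t"
      by - (rule Var_power_dvd_Var_power_times[of X Y M K], simp_all)
  qed
  have nonzero: "Const (Var X ^ M) \<noteq> (0 :: 'k S)"
    by (simp only: Const_eq_0_iff Var_power_nonzero not_False_eq_True)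
  show thesis by (rule parallel_is_multiple[OF p nonzero p' regular assms]) (assumption | rule that)+
qed

text \<open>The degree part of the Hilbert-Burch theorem. The vector \<open>m = a \<times> b\<close> of minors is orthogonal to both columns, as is
  \<open>d\<close>; hence it is parallel to \<open>d\<close> and \<open>m = c d\<close>. Conversely, the three Koszul relations between the entries
  of \<open>d\<close> are combinations of the columns. The cross product of two of these relations is \<open>d\<close> times an entry
  of \<open>d\<close> on the one hand, and a multiple of \<open>m\<close> on the other, so \<open>c\<close> divides each entry of \<open>d\<close>. Then \<open>c\<close>
  divides a power of \<open>x\<close> and a power of \<open>y\<close>, so it is a unit, and \<open>m\<close> and \<open>d\<close> have the same degree.\<close>

lemma degree_eq_sum:
  assumes d: "homogeneous n d1" "homogeneous n d2" "homogeneous n d3"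
    and a: "homogeneous r a1" "homogeneous r a2" "homogeneous r a3"
    and b: "homogeneous s b1" "homogeneous s b2" "homogeneous s b3"
  shows "n = r + s"
proof -
  define m1 m2 m3 where m: "m1 = a2 * b3 - a3 * b2" "m2 = a3 * b1 - a1 * b3" "m3 = a1 * b2 - a2 * b1"
  have hm: "homogeneous (r + s) m1" "homogeneous (r + s) m2" "homogeneous (r + s) m3"
    unfolding m by (intro homogeneous_diff homogeneous_mult a b)+
  have "m1 * d2 = m2 * d1" "m1 * d3 = m3 * d1" "m2 * d3 = m3 * d2"
  proof -
    have "m1 * d2 - m2 * d1 = b3 * (d1 * a1 + d2 * a2 + d3 * a3) - a3 * (d1 * b1 + d2 * b2 + d3 * b3)"
      "m1 * d3 - m3 * d1 = a2 * (d1 * b1 + d2 * b2 + d3 * b3) - b2 * (d1 * a1 + d2 * a2 + d3 * a3)"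
      "m2 * d3 - m3 * d2 = b1 * (d1 * a1 + d2 * a2 + d3 * a3) - a1 * (d1 * b1 + d2 * b2 + d3 * b3)"
      unfolding m by (simp_all add: algebra_simps)
    then show "m1 * d2 = m2 * d1" "m1 * d3 = m3 * d1" "m2 * d3 = m3 * d2"
      unfolding complex by simp_all
  qed
  then obtain c where c: "m1 = c * d1" "m2 = c * d2" "m3 = c * d3" by (rule parallel_R)
  obtain M p1 p2 p3 where p: "Var X ^ M = p1 * d1 + p2 * d2 + p3 * d3" using x_power by blast
  obtain K p1' p2' p3' where p': "Var Y ^ K = p1' * d1 + p2' * d2 + p3' * d3" using y_power by blast
  have nonzero: "d1 \<noteq> 0 \<or> d2 \<noteq> 0 \<or> d3 \<noteq> 0"
  proof (rule ccontr)
    assume "\<not> ?thesis"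
    then have "Var X ^ M = (0 :: 'k R)" unfolding p by simp
    then show False using Var_power_nonzero[of X M] by (rule notE[rotated])
  qed
  have "d1 * 0 + d2 * d3 + d3 * - d2 = 0" "d1 * - d3 + d2 * 0 + d3 * d1 = 0"
    "d1 * d2 + d2 * - d1 + d3 * 0 = 0"
    by (simp_all add: algebra_simps)
  from this[THEN exact] obtain \<alpha>1 \<beta>1 \<alpha>2 \<beta>2 \<alpha>3 \<beta>3 where k:
    "0 = a1 * \<alpha>1 + b1 * \<beta>1" "d3 = a2 * \<alpha>1 + b2 * \<beta>1" "- d2 = a3 * \<alpha>1 + b3 * \<beta>1"
    "- d3 = a1 * \<alpha>2 + b1 * \<beta>2" "0 = a2 * \<alpha>2 + b2 * \<beta>2" "d1 = a3 * \<alpha>2 + b3 * \<beta>2"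
    "d2 = a1 * \<alpha>3 + b1 * \<beta>3" "- d1 = a2 * \<alpha>3 + b2 * \<beta>3" "0 = a3 * \<alpha>3 + b3 * \<beta>3"
    by blast
  (* The cross product of two combinations of the columns is a determinant times m. *)
  have cross: "(a2 * \<alpha> + b2 * \<beta>) * (a3 * \<alpha>' + b3 * \<beta>') - (a3 * \<alpha> + b3 * \<beta>) * (a2 * \<alpha>' + b2 * \<beta>')
      = (\<alpha> * \<beta>' - \<alpha>' * \<beta>) * c * d1"
    "(a3 * \<alpha> + b3 * \<beta>) * (a1 * \<alpha>' + b1 * \<beta>') - (a1 * \<alpha> + b1 * \<beta>) * (a3 * \<alpha>' + b3 * \<beta>')
      = (\<alpha> * \<beta>' - \<alpha>' * \<beta>) * c * d2"
    "(a1 * \<alpha> + b1 * \<beta>) * (a2 * \<alpha>' + b2 * \<beta>') - (a2 * \<alpha> + b2 * \<beta>) * (a1 * \<alpha>' + b1 * \<beta>')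
      = (\<alpha> * \<beta>' - \<alpha>' * \<beta>) * c * d3" for \<alpha> \<beta> \<alpha>' \<beta>'
    unfolding mult.assoc c[symmetric] m by (simp_all add: algebra_simps)
  have cancel: "x = y" if "x * d1 = y * d1" "x * d2 = y * d2" "x * d3 = y * d3" for x y
    using nonzero that mult_right_cancel by blast
  have "d3 = (\<alpha>1 * \<beta>2 - \<alpha>2 * \<beta>1) * c" "d1 = (\<alpha>2 * \<beta>3 - \<alpha>3 * \<beta>2) * c" "d2 = (\<alpha>3 * \<beta>1 - \<alpha>1 * \<beta>3) * c"
    by (rule cancel; simp only: cross[symmetric] flip: k; simp add: mult.commute)+
  then have "c dvd d1" "c dvd d2" "c dvd d3" by (metis dvd_triv_right)+
  then have "c dvd Var X ^ M" "c dvd Var Y ^ K" unfolding p p' by simp_all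
  then obtain q q' where q: "Var X ^ M = c * q" "Var Y ^ K = c * q'" by (elim dvdE)
  then have "Var Y ^ K * q = Var X ^ M * q'" by (simp only: ac_simps)
  then have "Var X ^ M dvd q" by - (rule Var_power_dvd_Var_power_times[of X Y M K], simp_all)
  then obtain u where "q = Var X ^ M * u" by (elim dvdE)
  with q(1) have "Var X ^ M * 1 = Var X ^ M * (c * u)" by (simp only: mult_1_right mult.left_commute)
  then have "1 = c * u" unfolding mult_left_cancel[OF Var_power_nonzero] .
  then have "c dvd 1" by (metis dvd_triv_left)
  then have "coef c 0 \<noteq> 0" by (rule constant_coef_of_unit)
  note degree = homogeneous_multiple_degree[OF _ _ _ this]
  show ?thesis
    using nonzero degree[OF d(1) _ hm(1)[unfolded c]] degree[OF d(2) _ hm(2)[unfolded c]]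
      degree[OF d(3) _ hm(3)[unfolded c]] by metis
qed

text \<open>The vector \<open>w = \<alpha> a + \<beta> b\<close> is orthogonal to \<open>T\<close> by the relation, and to \<open>d\<close> because the columns are. So
  it is a multiple of \<open>T \<times> d\<close>, whose entries have degree \<open>n > e\<close> in \<open>x\<close> and \<open>y\<close>, and must vanish.\<close>

lemma forms_have_no_low_syzygy:
  fixes \<alpha> \<beta> :: "'k S"
  assumes d: "homogeneous n d1" "homogeneous n d2" "homogeneous n d3"
    and syzygy: "\<alpha> * (Var T1 * Const a1 + Var T2 * Const a2 + Var T3 * Const a3) +
      \<beta> * (Var T1 * Const b1 + Var T2 * Const b2 + Var T3 * Const b3) = 0"
    and form: "xy_form e (Const a1 * \<alpha> + Const b1 * \<beta>)" "xy_form e (Const a2 * \<alpha> + Const b2 * \<beta>)"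
      "xy_form e (Const a3 * \<alpha> + Const b3 * \<beta>)"
    and "e < n"
  shows "\<alpha> = 0 \<and> \<beta> = 0"
proof -
  define w1 w2 w3 where w: "w1 = Const a1 * \<alpha> + Const b1 * \<beta>" "w2 = Const a2 * \<alpha> + Const b2 * \<beta>"
    "w3 = Const a3 * \<alpha> + Const b3 * \<beta>"
  have "Var T1 * w1 + Var T2 * w2 + Var T3 * w3 = 0"
    using syzygy unfolding w by (simp add: algebra_simps)
  moreover have "Const d1 * w1 + Const d2 * w2 + Const d3 * w3 = 0"
  proof -
    have "Const d1 * w1 + Const d2 * w2 + Const d3 * w3
      = Const (d1 * a1 + d2 * a2 + d3 * a3) * \<alpha> + Const (d1 * b1 + d2 * b2 + d3 * b3) * \<beta>"
      unfolding w by (simp add: Const_add Const_mult algebra_simps)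
    then show ?thesis by (simp add: complex)
  qed
  ultimately have "\<exists>q. w1 = q * (Var T2 * Const d3 - Var T3 * Const d2) \<and>
     w2 = q * (Var T3 * Const d1 - Var T1 * Const d3) \<and>
     w3 = q * (Var T1 * Const d2 - Var T2 * Const d1)"
  proof (intro orthogonal_to_variables_and_constants[of T1 T2 T3 d2 d1 d3 w1 w2 w3])
    fix z1 z2 z3 :: "'k S"
    assume "z1 * Const d2 = z2 * Const d1" "z1 * Const d3 = z3 * Const d1" "z2 * Const d3 = z3 * Const d2"
    then obtain q where "z1 = q * Const d1" "z2 = q * Const d2" "z3 = q * Const d3" by (rule parallel_S)
    then show "\<exists>q. z1 = q * Const d1 \<and> z2 = q * Const d2 \<and> z3 = q * Const d3" by blast
  qed simp_all
  then obtain q where q: "w1 = q * (Var T2 * Const d3 - Var T3 * Const d2)"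
     "w2 = q * (Var T3 * Const d1 - Var T1 * Const d3)"
     "w3 = q * (Var T1 * Const d2 - Var T2 * Const d1)"
    by blast
  have form_d: "xy_form n (Var t * Const p)" if "homogeneous n p" for t and p :: "'k R"
    using xy_form_mult[OF xy_form_Var xy_form_Const[OF that]] by simp
  note vanishes = multiple_of_high_form_eq_0[OF _ xy_form_diff[OF form_d form_d] \<open>e < n\<close>]
  note form' = form[folded w, unfolded q]
  have "w1 = 0" unfolding q by (rule vanishes[OF form'(1) d(3) d(2)])
  moreover have "w2 = 0" unfolding q by (rule vanishes[OF form'(2) d(1) d(3)])
  moreover have "w3 = 0" unfolding q by (rule vanishes[OF form'(3) d(2) d(1)])
  moreover have "a1 * coef \<alpha> t + b1 * coef \<beta> t = coef w1 t"
    "a2 * coef \<alpha> t + b2 * coef \<beta> t = coef w2 t" "a3 * coef \<alpha> t + b3 * coef \<beta> t = coef w3 t" for t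
    unfolding w lookup_add coef_Const_times by (rule refl)+
  ultimately have "coef \<alpha> t = 0 \<and> coef \<beta> t = 0" for t
    by (intro injective) (simp_all only: lookup_zero)
  then show ?thesis by (auto intro!: poly_mapping_eqI)
qed

end

section \<open>The resultant\<close>

lemmas ideal_span_base = Modules.module.span_base[OF module_times]
lemmas ideal_span_scale = Modules.module.span_scale[OF module_times]
lemmas ideal_span_sum = Modules.module.span_sum[OF module_times]
lemmas ideal_span_induct_alt [consumes 1, case_names base step] = Modules.module.span_induct_alt[OF module_times]
lemmas ideal_subspace_0 = Modules.module.subspace_0[OF module_times]
lemmas ideal_subspace_add = Modules.module.subspace_add[OF module_times]
lemmas ideal_subspace_scale = Modules.module.subspace_scale[OF module_times]
lemmas ideal_subspace_span = Modules.module.subspace_span[OF module_times]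

lemma sum_lessThan_add: "(\<Sum>j<s + r. h j) = (\<Sum>j<s. h j) + (\<Sum>j<r. h (s + j :: nat))"
  by (induction r) (simp_all add: add.assoc)

lemma mat_times_sum:
  assumes "A \<in> carrier_mat n n" "C \<in> carrier_mat n n" "i < n" "k < n"
  shows "(A * C) $$ (i, k) = (\<Sum>j<n. A $$ (i, j) * C $$ (j, k))"
  using assms by (auto simp: scalar_prod_def atLeast0LessThan intro!: sum.cong)

lemma xy_form_eq_0:
  assumes "xy_form (m - 1) p" "0 < m" "\<And>i. i < m \<Longrightarrow> xy_coord m i p = 0"
  shows "p = 0"
  using xy_form_expand[OF assms(1,2)] assms(3) by simp

context rank_two_syzygies
begin

text \<open>The products of \<open>f\<close> with the \<open>s\<close> monomials of degree \<open>s - 1\<close>, and of \<open>g\<close> with the \<open>r\<close> monomials of degree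
  \<open>r - 1\<close>, are forms of degree \<open>r + s - 1\<close>. Their coordinates are the columns of the Sylvester matrix \<open>M\<close>, and
  \<open>p\<close> is its determinant. A kernel vector of \<open>M\<close> would be a relation between \<open>f\<close> and \<open>g\<close> that is excluded for
  reasons of degree. Multiplication by the adjugate of \<open>M\<close> writes \<open>p\<close> times each monomial as a
  combination of the columns, all of which lie in \<open>(f, g)\<close>.\<close>

lemma resultant_in_ideal:
  fixes f g :: "'k S"
  assumes f: "f = Var T1 * Const a1 + Var T2 * Const a2 + Var T3 * Const a3"
    and g: "g = Var T1 * Const b1 + Var T2 * Const b2 + Var T3 * Const b3"
    and d: "homogeneous (r + s) d1" "homogeneous (r + s) d2" "homogeneous (r + s) d3"
    and a: "homogeneous r a1" "homogeneous r a2" "homogeneous r a3"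
    and b: "homogeneous s b1" "homogeneous s b2" "homogeneous s b3"
  obtains p where "p \<noteq> 0" "\<And>i. i < r + s \<Longrightarrow> kT_to_S p * xy_monomials (r + s) ! i \<in> ideal_gen {f, g}"
proof
  let ?n = "r + s"
  have T: "xy_form i (Var t * Const c)" if "homogeneous i c" for i t and c :: "'k R"
    using xy_form_mult[OF xy_form_Var xy_form_Const[OF that]] by simp
  have ff: "xy_form r f" unfolding f by (intro xy_form_add T a)
  have fg: "xy_form s g" unfolding g by (intro xy_form_add T b)
  define syl where "syl j = (if j < s then xy_monomials s ! j * f else xy_monomials r ! (j - s) * g)" for j
  define M where "M = mat ?n ?n (\<lambda>(i, j). xy_coord ?n i (syl j))"
  have M: "M \<in> carrier_mat ?n ?n" by (simp add: M_def)
  have mono: "xy_form (m - 1) (xy_monomials m ! j)" if "j < m" for m j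
    using xy_form_monomial[of "m - 1 - j" j] that by simp
  have syl: "xy_form (?n - 1) (syl j)" if "j < ?n" for j
  proof (cases "j < s")
    case True
    then show ?thesis using xy_form_mult[OF mono[OF True] ff] by (simp add: syl_def add.commute)
  next
    case False
    with that have "j - s < r" by simp
    with False show ?thesis using xy_form_mult[OF mono[OF \<open>j - s < r\<close>] fg] by (simp add: syl_def)
  qed
  show "det M \<noteq> 0"
  proof
    assume "det M = 0"
    then obtain v where v: "v \<in> carrier_vec ?n" "v \<noteq> 0\<^sub>v ?n" "M *\<^sub>v v = 0\<^sub>v ?n"
      using det_0_iff_vec_prod_zero[OF M] by blast
    have "0 < ?n" using v(1,2) by (cases "?n = 0") auto
    define z where "z = (\<Sum>j<?n. kT_to_S (v $ j) * syl j)"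
    have "z = 0"
    proof (rule xy_form_eq_0[OF _ \<open>0 < ?n\<close>])
      show "xy_form (?n - 1) z"
        unfolding z_def using xy_form_mult[OF xy_form_kT syl] by (intro xy_form_sum) simp
      fix i
      assume i: "i < ?n"
      have "xy_coord ?n i z = (\<Sum>j<?n. xy_coord ?n i (syl j) * v $ j)"
        unfolding z_def xy_coord_sum xy_coord_kT_times by (simp only: mult.commute)
      also have "\<dots> = (M *\<^sub>v v) $ i"
        using i v(1) M by (auto simp: scalar_prod_def M_def atLeast0LessThan intro!: sum.cong)
      finally show "xy_coord ?n i z = 0" using i by (simp add: v(3))
    qed
    (* The kernel vector v, read as the coefficients of the two cofactors of f and g. *)
    define \<alpha> where "\<alpha> = (\<Sum>j<s. xy_monomials s ! j * kT_to_S (v $ j))"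
    define \<beta> where "\<beta> = (\<Sum>j<r. xy_monomials r ! j * kT_to_S (v $ (s + j)))"
    have "z = \<alpha> * f + \<beta> * g"
      unfolding z_def add.commute[of r s] sum_lessThan_add \<alpha>_def \<beta>_def sum_distrib_right
      by (intro arg_cong2[where f = "(+)"] sum.cong refl) (simp_all add: syl_def mult_ac)
    then have syz: "\<alpha> * f + \<beta> * g = 0" by (simp add: \<open>z = 0\<close>)
    have \<alpha>: "xy_form (?n - 1) (Const c * \<alpha>)" if "homogeneous r c" for c
      unfolding \<alpha>_def sum_distrib_left
    proof (intro xy_form_sum)
      fix j
      assume "j \<in> {..<s}"
      then have j: "j < s" by simp
      show "xy_form (?n - 1) (Const c * (xy_monomials s ! j * kT_to_S (v $ j)))"
        using xy_form_mult[OF xy_form_Const[OF that] xy_form_mult[OF mono[OF j] xy_form_kT]] j by simp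
    qed
    have \<beta>: "xy_form (?n - 1) (Const c * \<beta>)" if "homogeneous s c" for c
      unfolding \<beta>_def sum_distrib_left
    proof (intro xy_form_sum)
      fix j
      assume "j \<in> {..<r}"
      then have j: "j < r" by simp
      show "xy_form (?n - 1) (Const c * (xy_monomials r ! j * kT_to_S (v $ (s + j))))"
        using xy_form_mult[OF xy_form_Const[OF that] xy_form_mult[OF mono[OF j] xy_form_kT]] j
        by (simp add: add.commute)
    qed
    have "\<alpha> = 0 \<and> \<beta> = 0"
      using \<open>0 < ?n\<close>
      by (intro forms_have_no_low_syzygy[OF d syz[unfolded f g], of "?n - 1"] xy_form_add \<alpha> \<beta> a b) simp
    moreover have "xy_coord s j \<alpha> = v $ j" if "j < s" for j
      unfolding \<alpha>_def by (rule xy_coord_combination[OF that])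
    moreover have "xy_coord r j \<beta> = v $ (s + j)" if "j < r" for j
      unfolding \<beta>_def by (rule xy_coord_combination[OF that])
    ultimately have low: "v $ j = 0" if "j < s" for j using that by force
    have high: "v $ (s + j) = 0" if "j < r" for j
      using \<open>\<alpha> = 0 \<and> \<beta> = 0\<close> \<open>\<And>j. j < r \<Longrightarrow> xy_coord r j \<beta> = v $ (s + j)\<close>[OF that] by simp
    have "v $ j = 0" if "j < ?n" for j
      using low[of j] high[of "j - s"] that by (cases "j < s") auto
    then have "v = 0\<^sub>v ?n" using v(1) by (intro eq_vecI) auto
    then show False using v(2) by simp
  qed
  fix i
  assume i: "i < ?n"
  have adj: "adj_mat M \<in> carrier_mat ?n ?n" "M * adj_mat M = det M \<cdot>\<^sub>m 1\<^sub>m ?n"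
    using adj_mat[OF M] by auto
  have "(\<Sum>j<?n. syl j * kT_to_S (adj_mat M $$ (j, i)))
    = (\<Sum>j<?n. \<Sum>l<?n. xy_monomials ?n ! l * kT_to_S (M $$ (l, j) * adj_mat M $$ (j, i)))"
  proof (intro sum.cong refl)
    fix j
    assume "j \<in> {..<?n}"
    then have j: "j < ?n" by simp
    have "syl j = (\<Sum>l<?n. xy_monomials ?n ! l * kT_to_S (xy_coord ?n l (syl j)))"
      by (rule xy_form_expand[OF syl[OF j]]) (use j in linarith)
    then have "syl j * kT_to_S (adj_mat M $$ (j, i)) = 
      (\<Sum>l<?n. xy_monomials ?n ! l * kT_to_S (xy_coord ?n l (syl j))) * kT_to_S (adj_mat M $$ (j, i))"
      by (rule arg_cong[where f = "\<lambda>z. z * kT_to_S (adj_mat M $$ (j, i))"])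
    also have "\<dots> = (\<Sum>l<?n. xy_monomials ?n ! l * kT_to_S (M $$ (l, j) * adj_mat M $$ (j, i)))"
      unfolding sum_distrib_right using j by (intro sum.cong refl) (simp add: M_def kT_to_S_mult mult.assoc)
    finally show "syl j * kT_to_S (adj_mat M $$ (j, i)) = 
      (\<Sum>l<?n. xy_monomials ?n ! l * kT_to_S (M $$ (l, j) * adj_mat M $$ (j, i)))" .
  qed
  also have "\<dots> = (\<Sum>l<?n. xy_monomials ?n ! l * kT_to_S (\<Sum>j<?n. M $$ (l, j) * adj_mat M $$ (j, i)))"
    unfolding kT_to_S_sum sum_distrib_left by (rule sum.swap)
  also have "\<dots> = (\<Sum>l<?n. xy_monomials ?n ! l * kT_to_S (if l = i then det M else 0))"
  proof (intro sum.cong refl)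
    fix l
    assume "l \<in> {..<?n}"
    then have "(\<Sum>j<?n. M $$ (l, j) * adj_mat M $$ (j, i)) = (if l = i then det M else 0)"
      using i mat_times_sum[OF M adj(1), of l i, symmetric] by (simp add: adj(2))
    then show "xy_monomials ?n ! l * kT_to_S (\<Sum>j<?n. M $$ (l, j) * adj_mat M $$ (j, i))
      = xy_monomials ?n ! l * kT_to_S (if l = i then det M else 0)" by (simp only:)
  qed
  also have "\<dots> = (\<Sum>l<?n. if l = i then kT_to_S (det M) * xy_monomials ?n ! i else 0)"
    by (intro sum.cong refl) (auto simp: mult.commute)
  also have "\<dots> = kT_to_S (det M) * xy_monomials ?n ! i"
    using i by (simp del: nth_xy_monomials)
  finally have eq: "kT_to_S (det M) * xy_monomials ?n ! i = (\<Sum>j<?n. kT_to_S (adj_mat M $$ (j, i)) * syl j)"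
    by (simp only: mult.commute[of "syl _"])
  have "syl j \<in> ideal_gen {f, g}" for j
    unfolding syl_def by (auto intro!: ideal_span_scale intro: ideal_span_base)
  then show "kT_to_S (det M) * xy_monomials ?n ! i \<in> ideal_gen {f, g}"
    unfolding eq by (intro ideal_span_sum ideal_span_scale)
qed

end

section \<open>From the colon ideal to the matrix\<close>

text \<open>Each factor from \<open>(x, y)\<close> raises the degree of the monomial by one. This reduces membership in a colon
  ideal by \<open>(x, y)^m\<close> to monomials of degree \<open>e + m\<close>.\<close>

lemma ideal_power_multiplies_into:
  assumes Q: "is_ideal Q"
    and "\<And>i j. i + j = e + m \<Longrightarrow> p * (xS ^ i * yS ^ j) \<in> Q"
    and "b \<in> ideal_power (ideal_gen {xS, yS}) m" "i + j = e"
  shows "p * (xS ^ i * yS ^ j) * b \<in> Q"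
  using assms(2-4)
proof (induction m arbitrary: e i j b)
  case 0
  have "p * (xS ^ i * yS ^ j) \<in> Q" by (rule 0(1)) (simp add: 0(3))
  from ideal_subspace_scale[OF Q this, of b] show ?case by (simp only: mult.commute)
next
  case (Suc m)
  define z where "z = p * (xS ^ i * yS ^ j)"
  have absorb: "z * (u * v) \<in> Q"
    if u: "u \<in> ideal_gen {xS, yS}" and v: "v \<in> ideal_power (ideal_gen {xS, yS}) m" for u v
  proof -
    have raise: "p * (xS ^ i' * yS ^ j') * v \<in> Q" if "i' + j' = Suc e" for i' j'
      by (rule Suc.IH[OF _ v that]) (rule Suc.prems(1), simp)
    have "z * xS * v = p * (xS ^ Suc i * yS ^ j) * v" "z * yS * v = p * (xS ^ i * yS ^ Suc j) * v"
      unfolding z_def power_Suc by (simp_all only: ac_simps)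
    moreover have "Suc i + j = Suc e" "i + Suc j = Suc e" using Suc.prems(3) by simp_all
    ultimately have "z * xS * v \<in> Q" "z * yS * v \<in> Q" using raise by (simp_all only:)
    then have gen: "z * x * v \<in> Q" if "x \<in> {xS, yS}" for x using that by blast
    show ?thesis using u
    proof (induction rule: ideal_span_induct_alt)
      case base
      show ?case using ideal_subspace_0[OF Q] by simp
    next
      case (step c x y)
      have "z * ((c * x + y) * v) = c * (z * x * v) + z * (y * v)" by (simp add: algebra_simps)
      then show ?case
        using ideal_subspace_add[OF Q ideal_subspace_scale[OF Q gen[OF step(1)]] step(2)] by (simp only:)
    qed
  qed
  have "b \<in> ideal_gen {u * v |u v. u \<in> ideal_gen {xS, yS} \<and> v \<in> ideal_power (ideal_gen {xS, yS}) m}"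
    using Suc.prems(2) by (simp add: ideal_mult_def)
  then have "z * b \<in> Q"
  proof (induction rule: ideal_span_induct_alt)
    case base
    show ?case using ideal_subspace_0[OF Q] by simp
  next
    case (step c x y)
    then have "z * x \<in> Q" using absorb by blast
    moreover have "z * (c * x + y) = c * (z * x) + z * y" by (simp add: algebra_simps)
    ultimately show ?case
      using ideal_subspace_add[OF Q ideal_subspace_scale[OF Q] step(2)] by (simp only:)
  qed
  then show ?case unfolding z_def .
qed

text \<open>By linearity over \<open>k[T]\<close> it suffices to look at a monomial in \<open>x\<close>, \<open>y\<close> times a generator. If such a
  product has degree \<open>s - 1\<close>, then it is one of the columns: the degree \<open>s\<close> of \<open>g\<close> is too large, and the
  elements of \<open>hs\<close> can only be multiplied by 1. If it has another degree, its coordinates are zero.\<close>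

lemma column_span:
  fixes f g :: "'k::field S" and B :: "'k kT mat"
  assumes f: "xy_form r f" and g: "xy_form s g" and "r \<le> s" "length hs = r"
    and h: "\<And>h. h \<in> set hs \<Longrightarrow> xy_form (s - 1) h"
    and cols: "\<And>i j. i < s \<Longrightarrow> j < s \<Longrightarrow>
      xy_coord s i ((map (\<lambda>m. m * f) (xy_monomials (s - r)) @ hs) ! j) = B $$ (i, j)"
    and z: "z \<in> ideal_gen (set ([f, g] @ hs))"
  shows "\<exists>c. \<forall>i<s. xy_coord s i z = (\<Sum>j<s. B $$ (i, j) * c j)"
proof -
  define H where "H z \<longleftrightarrow> (\<exists>c. \<forall>i<s. xy_coord s i z = (\<Sum>j<s. B $$ (i, j) * c j))" for z
  have H_add: "H (z + z')" if z: "H z" "H z'" for z z'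
  proof -
    obtain c c' where "\<forall>i<s. xy_coord s i z = (\<Sum>j<s. B $$ (i, j) * c j)"
      "\<forall>i<s. xy_coord s i z' = (\<Sum>j<s. B $$ (i, j) * c' j)"
      using z unfolding H_def by blast
    then show ?thesis unfolding H_def
      by (intro exI[of _ "\<lambda>j. c j + c' j"]) (simp add: xy_coord_add distrib_left sum.distrib)
  qed
  have H_scale: "H (kT_to_S t * z)" if z: "H z" for t z
  proof -
    obtain c where "\<forall>i<s. xy_coord s i z = (\<Sum>j<s. B $$ (i, j) * c j)"
      using z unfolding H_def by blast
    then show ?thesis unfolding H_def
      by (intro exI[of _ "\<lambda>j. t * c j"])
        (simp add: xy_coord_kT_times sum_distrib_left mult.left_commute[of t])
  qed
  have H_col: "H ((map (\<lambda>m. m * f) (xy_monomials (s - r)) @ hs) ! j)" if "j < s" for j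
    unfolding H_def
  proof (intro exI[of _ "\<lambda>l. if l = j then 1 else 0"] allI impI)
    fix i
    assume "i < s"
    have "(\<Sum>l<s. B $$ (i, l) * (if l = j then 1 else 0)) = (\<Sum>l<s. if l = j then B $$ (i, j) else 0)"
      by (intro sum.cong) auto
    then show "xy_coord s i ((map (\<lambda>m. m * f) (xy_monomials (s - r)) @ hs) ! j)
        = (\<Sum>l<s. B $$ (i, l) * (if l = j then 1 else 0))"
      using that \<open>i < s\<close> by (simp add: cols)
  qed
  have H_other: "H z" if "xy_form d z" "d \<noteq> s - 1" for d z
    unfolding H_def by (intro exI[of _ "\<lambda>_. 0"]) (simp add: xy_coord_other_degree[OF that])
  (* For s = 0 the difference s - 1 is truncated to 0, but then there are no coordinates to compare. *)
  have H_none: "H z" if "s = 0" for z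
    using that by (simp add: H_def)
  have H_monomial: "H (xS ^ a * yS ^ b * q)" if "q \<in> set ([f, g] @ hs)" for a b q
  proof -
    consider "q = f" | "q = g" | "q \<in> set hs" using \<open>q \<in> _\<close> by auto
    then show ?thesis
    proof cases
      case 1
      show ?thesis
      proof (cases "s \<noteq> 0 \<and> a + b + r = s - 1")
        case True
        then have "b < s - r" "a = s - r - 1 - b" by auto
        then have "(map (\<lambda>m. m * f) (xy_monomials (s - r)) @ hs) ! b = xS ^ a * yS ^ b * f"
          by (simp add: nth_append)
        then show ?thesis using H_col[of b] \<open>b < s - r\<close> by (simp add: 1)
      next
        case False
        then show ?thesis
          using H_none H_other[OF xy_form_mult[OF xy_form_monomial f, of a b]] 1 by blast
      qed
    next
      case 2
      show ?thesis
        using H_none H_other[OF xy_form_mult[OF xy_form_monomial g, of a b]] 2 by (cases "s = 0") auto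
    next
      case 3
      show ?thesis
      proof (cases "a + b = 0")
        case True
        obtain l where "l < r" "q = hs ! l" using 3 \<open>length hs = r\<close> by (metis in_set_conv_nth)
        then have "(map (\<lambda>m. m * f) (xy_monomials (s - r)) @ hs) ! (s - r + l) = q"
          by (simp add: nth_append)
        then show ?thesis using H_col[of "s - r + l"] \<open>l < r\<close> \<open>r \<le> s\<close> True by simp
      next
        case False
        then show ?thesis
          using H_other[OF xy_form_mult[OF xy_form_monomial h[OF 3], of a b]] by simp
      qed
    qed
  qed
  have "H z" using z
  proof (induction rule: ideal_span_induct_alt)
    case base
    show ?case unfolding H_def by (intro exI[of _ "\<lambda>_. 0"]) simp
  next
    case (step c q y)
    show ?case
    proof (induction c rule: S_induct)
      case zero
      show ?case using step by simp
    next
      case (add c a b p)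
      have "(kT_to_S c * (xS ^ a * yS ^ b) + p) * q + y = kT_to_S c * (xS ^ a * yS ^ b * q) + (p * q + y)"
        by (simp add: algebra_simps)
      then show ?case using H_add[OF H_scale[OF H_monomial[OF step(1)]] add] by (simp only:)
    qed
  qed
  then show ?thesis unfolding H_def .
qed

lemma det_nonzero_if_multiple_of_identity_factors:
  fixes B :: "'a::idom mat"
  assumes B: "B \<in> carrier_mat n n" and "p \<noteq> 0"
    and c: "\<And>k. k < n \<Longrightarrow> \<exists>c. \<forall>i<n. (if i = k then p else 0) = (\<Sum>j<n. B $$ (i, j) * c j)"
  shows "det B \<noteq> 0"
proof -
  obtain c where c: "\<And>k i. k < n \<Longrightarrow> i < n \<Longrightarrow> (if i = k then p else 0) = (\<Sum>j<n. B $$ (i, j) * c k j)"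
    using c by metis
  define C where "C = mat n n (\<lambda>(j, k). c k j)"
  have C: "C \<in> carrier_mat n n" by (simp add: C_def)
  have "B * C = p \<cdot>\<^sub>m 1\<^sub>m n"
  proof (rule eq_matI)
    fix i k
    assume "i < dim_row (p \<cdot>\<^sub>m 1\<^sub>m n)" "k < dim_col (p \<cdot>\<^sub>m 1\<^sub>m n)"
    then have ik: "i < n" "k < n" by auto
    show "(B * C) $$ (i, k) = (p \<cdot>\<^sub>m 1\<^sub>m n) $$ (i, k)"
      unfolding mat_times_sum[OF B C ik] using c[OF ik(2,1), symmetric] ik by (simp add: C_def)
  qed (use B C in auto)
  then have "det B * det C = p ^ n" using det_mult[OF B C] by simp
  then show ?thesis using \<open>p \<noteq> 0\<close> by auto
qed

text \<open>Every term of the Leibniz expansion takes exactly one entry from each column.\<close>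

lemma homogeneous_det:
  assumes B: "B \<in> carrier_mat n n"
    and hom: "\<And>i j. i < n \<Longrightarrow> j < n \<Longrightarrow> homogeneous (e j) (B $$ (i, j))"
  shows "homogeneous (\<Sum>j<n. e j) (det B)"
  unfolding det_def'[OF B]
proof (rule homogeneous_sum)
  fix p
  assume "p \<in> {p. p permutes {0..<n}}"
  then have p: "p permutes {0..<n}" by simp
  have "homogeneous (\<Sum>i=0..<n. e (p i)) (\<Prod>i=0..<n. B $$ (i, p i))"
    using permutes_in_image[OF p] by (intro homogeneous_prod hom) auto
  moreover have "(\<Sum>i=0..<n. e (p i)) = (\<Sum>j<n. e j)"
    using sum.permute[OF p, of e] by (simp add: comp_def atLeast0LessThan)
  moreover have "signof p * q = q \<or> signof p * q = - q" for q :: "('a, 'b) mpoly"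
    by (simp add: sign_def)
  ultimately show "homogeneous (\<Sum>j<n. e j) (signof p * (\<Prod>i=0..<n. B $$ (i, p i)))"
    by (metis homogeneous_uminus)
qed

lemma homogeneous_xy_coord: "homogeneous e q \<Longrightarrow> homogeneous e (xy_coord m i q)"
  by (auto simp: homogeneous_def in_keys_iff coef_xy_coord)

section \<open>The determinant of B\<close>

lemma carrier_vec_3:
  assumes "w \<in> carrier_vec 3"
  shows "w = vec_of_list [w $ 0, w $ 1, w $ 2]"
  using assms by (intro eq_vecI) (auto simp: less_Suc_eq numeral_3_eq_3 numeral_2_eq_2 vec_of_list_index)

lemma carrier_vec_2:
  assumes "v \<in> carrier_vec 2"
  shows "v = vec_of_list [v $ 0, v $ 1]"
  using assms by (intro eq_vecI) (auto simp: less_Suc_eq numeral_2_eq_2 vec_of_list_index)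

lemma scalar_prod_3:
  fixes d1 d2 d3 :: "'a::comm_ring_1"
  shows "vec_of_list [d1, d2, d3] \<bullet> vec_of_list [w1, w2, w3] = d1 * w1 + d2 * w2 + d3 * w3"
  by (simp add: scalar_prod_def vec_of_list_index sum.atLeast0_lessThan_Suc numeral_3_eq_3 add.assoc)

lemma mult_mat_vec_3_2:
  fixes A :: "'a::comm_ring_1 mat"
  assumes "A \<in> carrier_mat 3 2"
  shows "A *\<^sub>v vec_of_list [a, b] = vec_of_list
    [A $$ (0, 0) * a + A $$ (0, 1) * b, A $$ (1, 0) * a + A $$ (1, 1) * b, A $$ (2, 0) * a + A $$ (2, 1) * b]"
  using assms
  by (intro eq_vecI) (auto simp: less_Suc_eq numeral_3_eq_3 numeral_2_eq_2 scalar_prod_def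
      vec_of_list_index sum.atLeast0_lessThan_Suc)

lemma vec_of_list_inject: "vec_of_list xs = vec_of_list ys \<longleftrightarrow> xs = ys"
  by (metis list_vec)

lemma vec_of_list_carrier: "length xs = n \<Longrightarrow> vec_of_list xs \<in> carrier_vec n"
  by (rule carrier_vecI) (rule trans[OF dim_vec_of_list])

text \<open>The ideal contains powers of \<open>x\<close> and \<open>y\<close> because its radical is \<open>(x, y)\<close>.\<close>

lemma rank_two_syzygies_of_resolution:
  fixes I :: "'k::field R set"
  assumes primary: "primary_to max_ideal I" and res: "min_free_resolution I [d1, d2, d3] phi"
  shows "rank_two_syzygies d1 d2 d3 (phi $$ (0, 0)) (phi $$ (1, 0)) (phi $$ (2, 0))
    (phi $$ (0, 1)) (phi $$ (1, 1)) (phi $$ (2, 1))"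
proof -
  note res' = res[unfolded min_free_resolution_def, THEN conjunct2]
  note phi = res'[THEN conjunct1]
  note onto = res'[THEN conjunct2, THEN conjunct1]
  note exact = res'[THEN conjunct2, THEN conjunct2, THEN conjunct1]
  note inj = res'[THEN conjunct2, THEN conjunct2, THEN conjunct2, THEN conjunct1]
  have vec2: "vec_of_list [a, b] \<in> carrier_vec 2" for a b :: "'k R"
    by (rule vec_of_list_carrier) simp
  have vec3: "vec_of_list [a, b, c] \<in> carrier_vec 3" for a b c :: "'k R"
    by (rule vec_of_list_carrier) simp
  have complex: "d1 * (phi $$ (0, 0) * a + phi $$ (0, 1) * b) + d2 * (phi $$ (1, 0) * a + phi $$ (1, 1) * b) +
    d3 * (phi $$ (2, 0) * a + phi $$ (2, 1) * b) = 0" for a b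
  proof -
    have "phi *\<^sub>v vec_of_list [a, b] \<in> {w \<in> carrier_vec 3. vec_of_list [d1, d2, d3] \<bullet> w = 0}"
      unfolding exact[symmetric] by (rule imageI[OF vec2])
    then show ?thesis by (simp only: mult_mat_vec_3_2[OF phi] mem_Collect_eq scalar_prod_3)
  qed
  have power: "\<exists>M p1 p2 p3. u ^ M = p1 * d1 + p2 * d2 + p3 * d3" if "u \<in> max_ideal" for u
  proof -
    have "u \<in> radical I" using primary that by (simp add: primary_to_def)
    then obtain M where "u ^ M \<in> I" by (auto simp: radical_def)
    then obtain w where "w \<in> carrier_vec 3" "u ^ M = vec_of_list [d1, d2, d3] \<bullet> w"
      unfolding onto[symmetric] by (elim imageE)
    then have "u ^ M = vec_of_list [d1, d2, d3] \<bullet> vec_of_list [w $ 0, w $ 1, w $ 2]"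
      by (simp only: carrier_vec_3[symmetric])
    then have "u ^ M = w $ 0 * d1 + w $ 1 * d2 + w $ 2 * d3"
      unfolding scalar_prod_3 by (simp only: mult.commute)
    then show ?thesis by blast
  qed
  show ?thesis
  proof
    show "d1 * phi $$ (0, 0) + d2 * phi $$ (1, 0) + d3 * phi $$ (2, 0) = 0" using complex[of 1 0] by simp
    show "d1 * phi $$ (0, 1) + d2 * phi $$ (1, 1) + d3 * phi $$ (2, 1) = 0" using complex[of 0 1] by simp
    show "\<exists>\<alpha> \<beta>. w1 = phi $$ (0, 0) * \<alpha> + phi $$ (0, 1) * \<beta> \<and> w2 = phi $$ (1, 0) * \<alpha> + phi $$ (1, 1) * \<beta> \<and>
        w3 = phi $$ (2, 0) * \<alpha> + phi $$ (2, 1) * \<beta>" if "d1 * w1 + d2 * w2 + d3 * w3 = 0" for w1 w2 w3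
    proof -
      have "vec_of_list [w1, w2, w3] \<in> {w \<in> carrier_vec 3. vec_of_list [d1, d2, d3] \<bullet> w = 0}"
        unfolding mem_Collect_eq scalar_prod_3 by (rule conjI[OF vec3 that])
      then obtain v where "v \<in> carrier_vec 2" "vec_of_list [w1, w2, w3] = phi *\<^sub>v v"
        unfolding exact[symmetric] by (elim imageE)
      then have "vec_of_list [w1, w2, w3] = phi *\<^sub>v vec_of_list [v $ 0, v $ 1]"
        by (simp only: carrier_vec_2[symmetric])
      then show ?thesis unfolding mult_mat_vec_3_2[OF phi] vec_of_list_inject by blast
    qed
    show "\<alpha> = 0 \<and> \<beta> = 0" if "phi $$ (0, 0) * \<alpha> + phi $$ (0, 1) * \<beta> = 0"
      "phi $$ (1, 0) * \<alpha> + phi $$ (1, 1) * \<beta> = 0" "phi $$ (2, 0) * \<alpha> + phi $$ (2, 1) * \<beta> = 0" for \<alpha> \<beta>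
    proof -
      have "phi *\<^sub>v vec_of_list [\<alpha>, \<beta>] = phi *\<^sub>v vec_of_list [0, 0]"
        unfolding mult_mat_vec_3_2[OF phi] using that by simp
      then have "vec_of_list [\<alpha>, \<beta>] = vec_of_list [0, 0]" by (rule inj_onD[OF inj _ vec2 vec2])
      then show ?thesis unfolding vec_of_list_inject by simp
    qed
    show "\<exists>M p1 p2 p3. Var X ^ M = p1 * d1 + p2 * d2 + p3 * d3"
      by (rule power) (simp add: max_ideal_def ideal_span_base)
    show "\<exists>K p1 p2 p3. Var Y ^ K = p1 * d1 + p2 * d2 + p3 * d3"
      by (rule power) (simp add: max_ideal_def ideal_span_base)
  qed
qed

lemma row_mat_index: "j < length xs \<Longrightarrow> row_mat xs $$ (0, j) = xs ! j"
  by (simp add: row_mat_def mat_of_rows_list_def)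

lemma row_mat_carrier: "row_mat xs \<in> carrier_mat 1 (length xs)"
  by (simp add: row_mat_def mat_of_rows_list_def)

lemma row_mat_times:
  assumes "A \<in> carrier_mat (length xs) m" "row_mat ys = row_mat xs * A" "j < m"
  shows "ys ! j = (\<Sum>i<length xs. xs ! i * A $$ (i, j))"
proof -
  have "length ys = m"
    using arg_cong[OF assms(2), of dim_col] assms(1) row_mat_carrier[of ys] by auto
  then have "ys ! j = (row_mat xs * A) $$ (0, j)"
    using row_mat_index[of j ys] assms(2,3) by simp
  also have "\<dots> = (\<Sum>i<length xs. xs ! i * A $$ (i, j))"
    using assms(1,3) row_mat_carrier[of xs] row_mat_index[of _ xs]
    by (auto simp: scalar_prod_def atLeast0LessThan intro!: sum.cong)
  finally show ?thesis .
qed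

theorem theorem3p1:
  fixes I :: "'k::field R set" and ds :: "'k R list" and phi :: "'k R mat"
    and f g :: "'k S" and hs :: "'k S list" and B :: "'k kT mat" and n r s :: nat
  assumes "primary_to max_ideal I"
    and "length ds = 3" and "\<forall>d\<in>set ds. homogeneous n d"
    and "minimally_generated_by I ds"
    and "min_free_resolution I ds phi"
    and "\<forall>i<3. homogeneous r (phi $$ (i, 0))"
    and "\<forall>i<3. homogeneous s (phi $$ (i, 1))"
    and "r \<le> s"
    and "row_mat [f, g] = row_mat [Var T1, Var T2, Var T3] * map_mat Const phi"
    and "length hs = r" and "\<forall>h\<in>set hs. bihomogeneous (s - 1) 2 h"
    and "minimally_generated_by
           (colon (ideal_gen {f, g}) (ideal_power (ideal_gen {xS, yS}) r)) ([f, g] @ hs)"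
    and "is_B_matrix r s f hs B"
  shows "det B \<noteq> 0 \<and> total_degree (det B) = n"
proof -
  obtain d1 d2 d3 where ds: "ds = [d1, d2, d3]"
    using assms(2) by (auto simp: numeral_3_eq_3 length_Suc_conv)
  interpret rank_two_syzygies d1 d2 d3 "phi $$ (0, 0)" "phi $$ (1, 0)" "phi $$ (2, 0)"
    "phi $$ (0, 1)" "phi $$ (1, 1)" "phi $$ (2, 1)"
    by (rule rank_two_syzygies_of_resolution[OF assms(1) assms(5)[unfolded ds]])
  have phi: "phi \<in> carrier_mat 3 2" using assms(5) by (simp add: min_free_resolution_def)
  have d: "homogeneous n d1" "homogeneous n d2" "homogeneous n d3" using assms(3) by (simp_all add: ds)
  have a: "homogeneous r (phi $$ (0, 0))" "homogeneous r (phi $$ (1, 0))" "homogeneous r (phi $$ (2, 0))"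
    and b: "homogeneous s (phi $$ (0, 1))" "homogeneous s (phi $$ (1, 1))" "homogeneous s (phi $$ (2, 1))"
    using assms(6,7) by simp_all
  have n: "n = r + s" by (rule degree_eq_sum[OF d a b])
  have entry: "[f, g] ! j = Var T1 * Const (phi $$ (0, j)) + Var T2 * Const (phi $$ (1, j)) + Var T3 * Const (phi $$ (2, j))"
    if "j < 2" for j
    using row_mat_times[OF _ assms(9) that] phi that
    by (simp add: numeral_3_eq_3 numeral_2_eq_2)
  have f: "f = Var T1 * Const (phi $$ (0, 0)) + Var T2 * Const (phi $$ (1, 0)) + Var T3 * Const (phi $$ (2, 0))"
    using entry[of 0] by simp
  have g: "g = Var T1 * Const (phi $$ (0, 1)) + Var T2 * Const (phi $$ (1, 1)) + Var T3 * Const (phi $$ (2, 1))"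
    using entry[of 1] by simp
  have T: "xy_form i (Var t * Const c)" if "homogeneous i c" for i t and c :: "'k R"
    using xy_form_mult[OF xy_form_Var xy_form_Const[OF that]] by simp
  have form_f: "xy_form r f" and form_g: "xy_form s g"
    unfolding f g by (intro xy_form_add T a b)+
  have form_h: "xy_form (s - 1) h" if "h \<in> set hs" for h
    using assms(11) that by (blast intro: bihomogeneous_xy_form)
  let ?cols = "map (\<lambda>m. m * f) (xy_monomials (s - r)) @ hs"
  have B: "B \<in> carrier_mat s s" and
    cols_eq: "row_mat ?cols = row_mat (xy_monomials s) * map_mat kT_to_S B"
  proof -
    show "B \<in> carrier_mat s s" using assms(13) by (simp add: is_B_matrix_def)
    (* For s = r there are no monomials in front, and both cases of the definition agree. *)
    have "(if s = r then hs else ?cols) = ?cols" by (simp add: xy_monomials_def)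
    then show "row_mat ?cols = row_mat (xy_monomials s) * map_mat kT_to_S B"
      using assms(13) by (simp add: is_B_matrix_def)
  qed
  have cols: "xy_coord s i (?cols ! j) = B $$ (i, j)" if "i < s" "j < s" for i j
  proof -
    have "?cols ! j = (\<Sum>l<s. xy_monomials s ! l * kT_to_S (B $$ (l, j)))"
      using row_mat_times[OF _ cols_eq \<open>j < s\<close>] B \<open>j < s\<close> by (simp del: nth_xy_monomials)
    then show ?thesis using xy_coord_combination[OF \<open>i < s\<close>] by simp
  qed
  obtain p where p: "p \<noteq> 0" "\<And>i. i < r + s \<Longrightarrow> kT_to_S p * xy_monomials (r + s) ! i \<in> ideal_gen {f, g}"
    using resultant_in_ideal[OF f g d[unfolded n] a b] by blast
  (* Multiplied by (x, y)^r, a monomial of degree s - 1 has degree r + s - 1, and p takes it into (f, g). *)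
  have N: "kT_to_S p * xy_monomials s ! k \<in> ideal_gen (set ([f, g] @ hs))" if "k < s" for k
  proof -
    have top: "kT_to_S p * (xS ^ i * yS ^ j) \<in> ideal_gen {f, g}" if "i + j = s - 1 + r" for i j
    proof -
      have "j < r + s" "r + s - 1 - j = i" using that \<open>k < s\<close> by auto
      then show ?thesis using p(2)[of j] by simp
    qed
    have "kT_to_S p * (xS ^ (s - 1 - k) * yS ^ k) * b \<in> ideal_gen {f, g}"
      if "b \<in> ideal_power (ideal_gen {xS, yS}) r" for b
      using \<open>k < s\<close> by (intro ideal_power_multiplies_into[OF ideal_subspace_span top that]) auto
    then have "kT_to_S p * xy_monomials s ! k \<in> colon (ideal_gen {f, g}) (ideal_power (ideal_gen {xS, yS}) r)"
      using \<open>k < s\<close> by (simp add: colon_def)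
    then show ?thesis using assms(12) by (simp only: minimally_generated_by_def)
  qed
  have "det B \<noteq> 0"
  proof (rule det_nonzero_if_multiple_of_identity_factors[OF B p(1)])
    fix k
    assume "k < s"
    have "xy_coord s i (kT_to_S p * xy_monomials s ! k) = (if i = k then p else 0)" if "i < s" for i
    proof -
      have "(\<Sum>j<s. xy_monomials s ! j * kT_to_S (if j = k then p else 0))
        = (\<Sum>j<s. if j = k then kT_to_S p * xy_monomials s ! k else 0)"
        by (intro sum.cong refl) (simp add: mult.commute)
      also have "\<dots> = kT_to_S p * xy_monomials s ! k"
        using \<open>k < s\<close> by (simp del: nth_xy_monomials)
      finally show ?thesis
        using xy_coord_combination[OF that, of "\<lambda>j. if j = k then p else 0"] by (simp only:)
    qed
    moreover obtain c where
      "\<forall>i<s. xy_coord s i (kT_to_S p * xy_monomials s ! k) = (\<Sum>j<s. B $$ (i, j) * c j)"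
      using column_span[OF form_f form_g assms(8,10) form_h cols N[OF \<open>k < s\<close>]] by blast
    ultimately show "\<exists>c. \<forall>i<s. (if i = k then p else 0) = (\<Sum>j<s. B $$ (i, j) * c j)"
      by (intro exI[of _ c]) (simp del: nth_xy_monomials)
  qed
  moreover have "homogeneous n (det B)"
  proof -
    (* The degree in T of column j. *)
    define e where "e j = (if j < s - r then 1 else 2 :: nat)" for j
    have "homogeneous 1 f"
      using homogeneous_mult[OF homogeneous_Var homogeneous_Const] unfolding f
      by (intro homogeneous_add) simp_all
    then have col: "homogeneous (e j) (?cols ! j)" if "j < s" for j
    proof (cases "j < s - r")
      case True
      then show ?thesis
        using homogeneous_mult[OF homogeneous_Const \<open>homogeneous 1 f\<close>]
        by (simp add: e_def nth_append xy_monomial_Const)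
    next
      case False
      then have "?cols ! j = hs ! (j - (s - r))" "hs ! (j - (s - r)) \<in> set hs"
        using that assms(8,10) by (auto simp: nth_append)
      then show ?thesis
        using assms(11) False by (auto simp: e_def bihomogeneous_def homogeneous_def)
    qed
    have "homogeneous (\<Sum>j<s. e j) (det B)"
    proof (rule homogeneous_det[OF B])
      fix i j
      assume ij: "i < s" "j < s"
      show "homogeneous (e j) (B $$ (i, j))"
        using homogeneous_xy_coord[OF col[OF ij(2)], of s i] by (simp only: cols[OF ij])
    qed
    moreover have "(\<Sum>j<s. e j) = n"
    proof -
      have "(\<Sum>j<s. e j) = (\<Sum>j<s - r. e j) + (\<Sum>j<r. e (s - r + j))"
        using sum_lessThan_add[of e "s - r" r] assms(8) by (simp only: le_add_diff_inverse2)
      also have "\<dots> = (\<Sum>j<s - r. 1) + (\<Sum>j<r. 2)"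
        by (intro arg_cong2[where f = "(+)"] sum.cong refl) (simp_all add: e_def)
      finally show ?thesis using assms(8) by (simp add: n)
    qed
    ultimately show ?thesis by simp
  qed
  ultimately show ?thesis by (simp add: total_degree_homogeneous)
qed

end
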